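(* Let $Q$ be a generalized quadratic average of complexity at most $(d,\rho)$. Then for every $\alpha$ with $0<\alpha\leq 1/20$, either $\|Q\|_{U^2}\leq(12\alpha)^{1/8}$ or there exists a function $Q'':\mathbb{Z}_N\to\mathbb{C}$ such that $\|Q-Q''\|_\infty\leq 16d^2\alpha$ and $\|Q''\|_{U^2}^*\leq(4/\alpha)^{4d^2}(800d^2/\rho)^d$.
   Context: $\omega=e^{2\pi i/N}$, normalized averages $\mathbb{E}$, $\langle f,g\rangle=\mathbb{E}_xf(x)\overline{g(x)}$. $\|f\|_{U^2}^4=\mathbb{E}_{x,a,b}f(x)\overline{f(x+a)f(x+b)}f(x+a+b)$ and $\|f\|_{U^2}^*=\sup\{|\langle f,g\rangle|:\|g\|_{U^2}\leq1\}$. Bohr set $B(K,\rho)=\{x:|\omega^{rx}-1|\leq\rho\ \forall r\in K\}$; regular if for every $\epsilon>0$, $|B(K,\rho(1+\epsilon))|\leq|B|(1+100|K|\epsilon)$ and $|B(K,\rho(1-\epsilon))|\geq|B|(1-100|K|\epsilon)$. Freiman homomorphism on $A$: $\phi(x)+\phi(y)=\phi(z)+\phi(w)$ whenever $x,y,z,w\in A$, $x+y=z+w$. Quadratic map on $A$: $q:A\to\mathbb{Z}_N$ with $\sum_{\epsilon\in\{0,1\}^3}(-1)^{|\epsilon|}q(x+\epsilon_1a+\epsilon_2b+\epsilon_3c)=0$ whenever all eight points lie in $A$. A quadratic average with base $(B,q)$ ($B$ regular Bohr set, $q$ quadratic on $B$) is $Q(x)=\mathbb{E}_{y\in x-B}\omega^{q_y(x)}$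 where $q_y(x)=q(x-y)+\phi_y(x-y)$ on $B+y$ for Freiman homomorphisms $\phi_y:B\to\mathbb{Z}_N$. A generalized quadratic average with base $(B,q)$ is $n^{-1}(Q_1+\dots+Q_n)$ for quadratic averages $Q_i$ with base $(B,q)$. It has complexity at most $(d,\rho)$ if $B=B(K,\rho')$ with $|K|\leq d$ and $\rho'\geq\rho$.
   Formalization: The formal theorem assumes d ≥ 1 and 0 < ρ ≤ 2; as written the claim fails for d = 0 (Q = ω^{x²}, N odd, N > 1, α tiny) and for huge ρ (Q = 1, d = 1, α = 1/20), and the bound is undefined at ρ = 0. *)

theory Defs
  imports
    "HOL-Analysis.Analysis"
    "Berlekamp_Zassenhaus.Finite_Field"
begin

text \<open>The group \<open>\<int>\<^sub>N\<close> is the type \<open>'n mod_ring\<close> with \<open>'n\<close> an arbitrary finite type and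
  \<open>N = CARD('n)\<close>.\<close>

definition expect :: "'a set \<Rightarrow> ('a \<Rightarrow> complex) \<Rightarrow> complex" where
  "expect A f = (\<Sum>x\<in>A. f x) / of_nat (card A)"

definition omega_pow :: "'n::finite mod_ring \<Rightarrow> complex" where
  "omega_pow t = exp (2 * of_real pi * \<i> / of_nat CARD('n)) ^ nat (to_int_mod_ring t)"

definition inner_avg :: "('n::finite mod_ring \<Rightarrow> complex) \<Rightarrow> ('n mod_ring \<Rightarrow> complex) \<Rightarrow> complex" where
  "inner_avg f g = expect UNIV (\<lambda>x. f x * cnj (g x))"

definition sup_norm :: "('n::finite mod_ring \<Rightarrow> complex) \<Rightarrow> real" where
  "sup_norm f = Max (range (\<lambda>x. cmod (f x)))"

text \<open>The average below is a nonnegative real number, so taking its real part loses nothing.\<close>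

definition U2_norm :: "('n::finite mod_ring \<Rightarrow> complex) \<Rightarrow> real" where
  "U2_norm f = root 4 (Re (expect UNIV (\<lambda>x. expect UNIV (\<lambda>a. expect UNIV (\<lambda>b.
      f x * cnj (f (x + a) * f (x + b)) * f (x + a + b))))))"

text \<open>As \<^term>\<open>U2_norm\<close> is a norm on a finite-dimensional space, the set is bounded, so the
  real-valued supremum is the genuine one.\<close>

definition U2_dual_norm :: "('n::finite mod_ring \<Rightarrow> complex) \<Rightarrow> real" where
  "U2_dual_norm f = Sup {cmod (inner_avg f g) | g. U2_norm g \<le> 1}"

definition bohr_set :: "'n::finite mod_ring set \<Rightarrow> real \<Rightarrow> 'n mod_ring set" where
  "bohr_set K \<rho> = {x. \<forall>r\<in>K. cmod (omega_pow (r * x) - 1) \<le> \<rho>}"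

text \<open>Regularity refers to the frequency set and the radius, not just to the underlying set of
  points, so Bohr sets are passed around as pairs \<open>K\<close>, \<open>\<rho>\<close>.\<close>

definition regular_bohr :: "'n::finite mod_ring set \<Rightarrow> real \<Rightarrow> bool" where
  "regular_bohr K \<rho> \<longleftrightarrow> (\<forall>\<epsilon>>0.
      real (card (bohr_set K (\<rho> * (1 + \<epsilon>)))) \<le> real (card (bohr_set K \<rho>)) * (1 + 100 * real (card K) * \<epsilon>) \<and>
      real (card (bohr_set K (\<rho> * (1 - \<epsilon>)))) \<ge> real (card (bohr_set K \<rho>)) * (1 - 100 * real (card K) * \<epsilon>))"

text \<open>Maps defined on a subset \<open>A\<close> are total functions whose values outside \<open>A\<close> are never used.\<close>

definition freiman_hom_on :: "'n::finite mod_ring set \<Rightarrow> ('n mod_ring \<Rightarrow> 'n mod_ring) \<Rightarrow> bool" where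
  "freiman_hom_on A \<phi> \<longleftrightarrow>
    (\<forall>x\<in>A. \<forall>y\<in>A. \<forall>z\<in>A. \<forall>w\<in>A. x + y = z + w \<longrightarrow> \<phi> x + \<phi> y = \<phi> z + \<phi> w)"

definition quadratic_map_on :: "'n::finite mod_ring set \<Rightarrow> ('n mod_ring \<Rightarrow> 'n mod_ring) \<Rightarrow> bool" where
  "quadratic_map_on A q \<longleftrightarrow> (\<forall>x a b c.
    {x, x + a, x + b, x + c, x + a + b, x + a + c, x + b + c, x + a + b + c} \<subseteq> A \<longrightarrow>
    q x - q (x + a) - q (x + b) - q (x + c)
      + q (x + a + b) + q (x + a + c) + q (x + b + c) - q (x + a + b + c) = 0)"

text \<open>The base \<open>(B, q)\<close> has \<open>B = bohr_set K \<rho>\<close>. In the average, \<open>y \<in> x - B\<close> means that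
  \<open>x - y \<in> B\<close>, so \<open>q\<close> and \<open>\<phi> y\<close> are evaluated on \<open>B\<close> only.\<close>

definition quadratic_average ::
  "'n::finite mod_ring set \<Rightarrow> real \<Rightarrow> ('n mod_ring \<Rightarrow> 'n mod_ring) \<Rightarrow> ('n mod_ring \<Rightarrow> complex) \<Rightarrow> bool" where
  "quadratic_average K \<rho> q Q \<longleftrightarrow>
    regular_bohr K \<rho> \<and> quadratic_map_on (bohr_set K \<rho>) q \<and>
    (\<exists>\<phi>. (\<forall>y. freiman_hom_on (bohr_set K \<rho>) (\<phi> y)) \<and>
      (\<forall>x. Q x = expect ((\<lambda>u. x - u) ` bohr_set K \<rho>)
                   (\<lambda>y. omega_pow (q (x - y) + \<phi> y (x - y)))))"

definition generalized_quadratic_average ::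
  "'n::finite mod_ring set \<Rightarrow> real \<Rightarrow> ('n mod_ring \<Rightarrow> 'n mod_ring) \<Rightarrow> ('n mod_ring \<Rightarrow> complex) \<Rightarrow> bool" where
  "generalized_quadratic_average K \<rho> q Q \<longleftrightarrow>
    (\<exists>n\<ge>1. \<exists>Qs::nat \<Rightarrow> 'n mod_ring \<Rightarrow> complex.
      (\<forall>i<n. quadratic_average K \<rho> q (Qs i)) \<and>
      (\<forall>x. Q x = (\<Sum>i<n. Qs i x) / of_nat n))"

definition gqa_of_complexity_at_most ::
  "nat \<Rightarrow> real \<Rightarrow> ('n::finite mod_ring \<Rightarrow> complex) \<Rightarrow> bool" where
  "gqa_of_complexity_at_most d \<rho> Q \<longleftrightarrow>
    (\<exists>K \<rho>' q. card K \<le> d \<and> \<rho> \<le> \<rho>' \<and> generalized_quadratic_average K \<rho>' q Q)"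

end

theory Submission
  imports Defs
begin

text \<open>Let \<open>\<beta>(h, k) = q(h + k) - q(h) - q(k) + q(0)\<close>, which is bilinear on a small dilate of \<open>B\<close>. Adding
  a Freiman homomorphism or a character to \<open>q\<close> does not change \<open>\<beta>\<close>. Fix a radius \<open>s\<close>, a small multiple
  of the radius of \<open>B\<close>, such that the Bohr set \<open>B\<^sub>s\<close> is almost unchanged by translations from a
  much smaller \<open>B\<^sub>\<tau>\<close>.

  If for each \<open>h' \<in> B\<^sub>s\<close> the average of \<open>\<omega>\<^sup>\<beta>\<close> at \<open>(h - h', k)\<close> over \<open>k \<in> B\<^sub>s\<close> is small for most
  \<open>h \<in> B\<^sub>s\<close>, then the Cauchy-Schwarz inequality shows that all exponential sums of \<open>q\<close> plus a
  Freiman homomorphism over \<open>B\<close> are small. So all Fourier coefficients of \<open>Q\<close> are small, and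
  \<open>\<parallel>Q\<parallel>\<close> in \<open>U\<^sup>2\<close> is bounded by the square root of the largest one.

  Otherwise there is a dense set \<open>H\<close> of differences \<open>h - h'\<close> for which the character \<open>\<omega>\<^sup>\<beta>\<close> of the
  second variable has a large average over \<open>B\<^sub>s\<close>; such a character is close to \<open>1\<close> on \<open>B\<^sub>\<tau>\<close>. Averaging
  the definition of \<open>Q\<close> over shifts by \<open>h + k\<close> with \<open>h \<in> H\<close>, \<open>k \<in> B\<^sub>\<tau>\<close> changes it little, and up to the
  factor \<open>\<omega>\<^sup>\<beta>\<close> the phase splits into a function of \<open>h\<close> times a function of \<open>k\<close>. Such an average has
  dual norm at most \<open>N / (\<bar>H\<bar> \<bar>B\<^sub>\<tau>\<bar>)\<^bsup>1/2\<^esup>\<close> by two applications of the Cauchy-Schwarz inequality.\<close>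

section \<open>Characters and Bohr sets\<close>

lemma omega_pow_cis:
  "omega_pow (t :: 'n::finite mod_ring) = cis (2 * pi * real_of_int (to_int_mod_ring t) / real CARD('n))"
proof -
  have nonneg: "0 \<le> to_int_mod_ring t"
    using range_to_int_mod_ring[where 'a='n] by (metis atLeastLessThan_iff rangeI)
  have "exp (2 * of_real pi * \<i> / of_nat CARD('n)) = cis (2 * pi / real CARD('n))"
    by (simp add: cis_conv_exp mult.commute)
  then show ?thesis
    using nonneg unfolding omega_pow_def by (simp add: Complex.DeMoivre mult.commute)
qed

lemma norm_omega_pow [simp]: "cmod (omega_pow t) = 1"
  by (simp add: omega_pow_cis)

lemma omega_pow_0 [simp]: "omega_pow 0 = 1"
  by (simp add: omega_pow_def)

lemma cis_2pi_of_int: "cis (2 * pi * real_of_int m) = 1"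
  by (metis cis_multiple_2pi Ints_of_int)

lemma omega_pow_add: "omega_pow (s + t) = omega_pow s * omega_pow (t :: 'n::finite mod_ring)"
proof -
  let ?N = "int CARD('n)"
  define a b where "a = to_int_mod_ring s" and "b = to_int_mod_ring t"
  have "to_int_mod_ring (s + t) = (a + b) mod ?N"
    unfolding a_def b_def by transfer simp
  moreover have "a + b = (a + b) mod ?N + ?N * ((a + b) div ?N)"
    by simp
  ultimately have "a + b = to_int_mod_ring (s + t) + ?N * ((a + b) div ?N)"
    by simp
  then have "real_of_int a + real_of_int b
      = real_of_int (to_int_mod_ring (s + t)) + real CARD('n) * real_of_int ((a + b) div ?N)"
    by (metis (no_types, lifting) of_int_add of_int_mult of_int_of_nat_eq)
  then have "2 * pi * real_of_int a / real CARD('n) + 2 * pi * real_of_int b / real CARD('n)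
      = 2 * pi * real_of_int (to_int_mod_ring (s + t)) / real CARD('n)
        + 2 * pi * real_of_int ((a + b) div ?N)"
    by (simp add: divide_simps) (simp add: mult.assoc flip: distrib_left)
  then have "cis (2 * pi * real_of_int a / real CARD('n)) * cis (2 * pi * real_of_int b / real CARD('n))
      = cis (2 * pi * real_of_int (to_int_mod_ring (s + t)) / real CARD('n))"
    by (metis cis_mult cis_2pi_of_int mult.right_neutral)
  then show ?thesis
    by (simp add: omega_pow_cis a_def b_def)
qed

lemma omega_pow_uminus: "omega_pow (- t) = cnj (omega_pow t)"
proof -
  have "omega_pow (- t) * omega_pow t = 1"
    using omega_pow_add[of "- t" t] by simp
  moreover have "cnj (omega_pow t) * omega_pow t = 1"
    by (metis complex_norm_square mult.commute norm_omega_pow of_real_1 power_one)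
  ultimately show ?thesis
    by (metis mult_cancel_right zero_neq_one mult_zero_right)
qed

lemma omega_pow_diff: "omega_pow (s - t) = omega_pow s * cnj (omega_pow t)"
  using omega_pow_add[of s "- t"] by (simp add: omega_pow_uminus)

lemma omega_pow_eq_1_imp:
  assumes "omega_pow (t :: 'n::finite mod_ring) = 1" shows "t = 0"
proof -
  define a where "a = to_int_mod_ring t"
  have a: "0 \<le> a" "a < int CARD('n)"
    using range_to_int_mod_ring[where 'a='n] unfolding a_def by (metis atLeastLessThan_iff rangeI)+
  have "cis (2 * pi * real_of_int a / real CARD('n)) = 1"
    using assms by (simp add: omega_pow_cis a_def)
  then have "cos (2 * pi * real_of_int a / real CARD('n)) = 1"
    by (metis cis.sel(1) one_complex.sel(1))
  then obtain m :: int where "2 * pi * real_of_int a / real CARD('n) = real_of_int m * 2 * pi"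
    using cos_one_2pi_int by auto
  then have "real_of_int a = real_of_int m * real CARD('n)"
    by (simp add: field_simps)
  then have "a = m * int CARD('n)"
    by (metis of_int_eq_iff of_int_mult of_int_of_nat_eq)
  with a have "a = 0"
    by (metis mod_mult_self2_is_0 mod_pos_pos_trivial mult.commute)
  then show ?thesis
    by (simp add: a_def)
qed

text \<open>Shifting the summation variable by the unit multiplies the sum by
  \<open>omega_pow x\<close>, which differs from 1 when \<open>x\<close> is nonzero. No inverse of
  \<open>x\<close> is taken, so the modulus may be composite.\<close>

lemma sum_omega_pow_mult:
  "(\<Sum>r\<in>UNIV. omega_pow (r * x)) = (if x = 0 then of_nat CARD('n) else 0)"
  for x :: "'n::finite mod_ring"
proof (cases "x = 0")
  case False
  \<comment> \<open>The unit is written as the residue of 1 because \<open>CARD('n) = 1\<close> is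
    allowed, where it equals 0.\<close>
  define e :: "'n mod_ring" where "e = of_int_mod_ring 1"
  have ex: "e * x = x"
    unfolding e_def by transfer (simp add: mod_mult_left_eq)
  have "(\<Sum>r\<in>UNIV. omega_pow (r * x)) = (\<Sum>r\<in>UNIV. omega_pow ((r + e) * x))"
    by (rule sum.reindex_bij_witness[where i = "\<lambda>r. r + e" and j = "\<lambda>r. r - e"]) auto
  also have "\<dots> = omega_pow x * (\<Sum>r\<in>UNIV. omega_pow (r * x))"
    by (simp only: distrib_right ex omega_pow_add sum_distrib_left mult.commute[of "omega_pow x"])
  finally show ?thesis
    using False omega_pow_eq_1_imp[of x] by (auto simp: mult_cancel_right1)
qed simp

section \<open>Elementary properties of Bohr sets\<close>

lemma bohr_set_0 [simp]: "0 \<le> r \<Longrightarrow> 0 \<in> bohr_set K r"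
  by (simp add: bohr_set_def)

lemma bohr_set_mono: "r \<le> s \<Longrightarrow> bohr_set K r \<subseteq> bohr_set K s"
  by (auto simp: bohr_set_def)

text \<open>For unimodular \<open>z\<close> and \<open>w\<close>,
  \<open>z * w - 1 = z * (w - 1) + (z - 1)\<close>, so radii add. The inclusions between shifted
  Bohr sets used later come from this.\<close>

lemma bohr_set_add:
  assumes "x \<in> bohr_set K r" "y \<in> bohr_set K s" shows "x + y \<in> bohr_set K (r + s)"
  unfolding bohr_set_def
proof (clarify)
  fix k assume k: "k \<in> K"
  have "omega_pow (k * (x + y)) - 1
      = omega_pow (k * x) * (omega_pow (k * y) - 1) + (omega_pow (k * x) - 1)"
    by (simp add: distrib_left omega_pow_add algebra_simps)
  then have "cmod (omega_pow (k * (x + y)) - 1) \<le> cmod (omega_pow (k * y) - 1) + cmod (omega_pow (k * x) - 1)"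
    by (metis norm_triangle_ineq norm_mult norm_omega_pow mult_1)
  also have "\<dots> \<le> r + s"
    using assms k unfolding bohr_set_def by (simp add: add.commute add_mono)
  finally show "cmod (omega_pow (k * (x + y)) - 1) \<le> r + s" .
qed

lemma bohr_set_uminus:
  assumes "x \<in> bohr_set K r" shows "- x \<in> bohr_set K r"
proof -
  have "cmod (omega_pow (k * - x) - 1) = cmod (omega_pow (k * x) - 1)" for k
    by (metis complex_cnj_cnj complex_cnj_diff complex_cnj_one complex_mod_cnj mult_minus_right omega_pow_uminus)
  then show ?thesis
    using assms unfolding bohr_set_def by simp
qed

lemma bohr_set_diff:
  "x \<in> bohr_set K r \<Longrightarrow> y \<in> bohr_set K s \<Longrightarrow> x - y \<in> bohr_set K (r + s)"
  using bohr_set_add[of x K r "- y" s] bohr_set_uminus[of y K s] by simp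

lemma bohr_set_card_pos: "0 \<le> r \<Longrightarrow> 0 < card (bohr_set K r)"
  using bohr_set_0[of r K] by (metis card_gt_0_iff empty_iff finite)

lemma in_bohr_set_diff_iff:
  "x - y \<in> bohr_set K r \<longleftrightarrow> (\<forall>k\<in>K. cmod (omega_pow (k * x) - omega_pow (k * y)) \<le> r)"
proof -
  have "cmod (omega_pow (k * (x - y)) - 1) = cmod (omega_pow (k * x) - omega_pow (k * y))" for k
  proof -
    have "omega_pow (k * y) * (omega_pow (k * (x - y)) - 1) = omega_pow (k * x) - omega_pow (k * y)"
      using omega_pow_add[of "k * y" "k * (x - y)"] by (simp add: algebra_simps)
    then show ?thesis
      by (metis mult_1 norm_mult norm_omega_pow)
  qed
  then show ?thesis
    by (simp add: bohr_set_def)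
qed

section \<open>Counting points of Bohr sets by pigeonhole\<close>

lemma card_le_image_times_fibre:
  assumes "finite A" "finite C" "g ` A \<subseteq> C"
    and fibre: "\<And>a. a \<in> A \<Longrightarrow> card {x \<in> A. g x = g a} \<le> m"
  shows "card A \<le> card C * m"
proof -
  have "card A = card (\<Union>c\<in>g ` A. {x \<in> A. g x = c})"
    by (rule arg_cong[where f = card]) auto
  also have "\<dots> \<le> (\<Sum>c\<in>g ` A. card {x \<in> A. g x = c})"
    using assms(1) by (intro card_UN_le) auto
  also have "\<dots> \<le> (\<Sum>c\<in>g ` A. m)"
    by (rule sum_mono) (use fibre in auto)
  also have "\<dots> \<le> card C * m"
    using card_mono[OF assms(2,3)] by simp
  finally show ?thesis .
qed

text \<open>Two points whose multiples by every frequency share a cell differ by an element of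
  \<open>bohr_set K r\<close>. So each pattern of cells is met by at most
  \<open>card (bohr_set K r)\<close> points, and there are at most \<open>card C ^ card K\<close>
  patterns. The cells will be arcs of the circle for the whole group and squares for the doubling
  bound.\<close>

lemma card_le_bohr_set_cells:
  fixes K :: "'n::finite mod_ring set" and cell :: "'n mod_ring \<Rightarrow> 'c"
  assumes "finite C" and "\<And>x k. x \<in> A \<Longrightarrow> k \<in> K \<Longrightarrow> cell (k * x) \<in> C"
    and close: "\<And>x y k. x \<in> A \<Longrightarrow> y \<in> A \<Longrightarrow> k \<in> K \<Longrightarrow> cell (k * x) = cell (k * y) \<Longrightarrow>
      cmod (omega_pow (k * x) - omega_pow (k * y)) \<le> r"
  shows "card A \<le> card C ^ card K * card (bohr_set K r)"
proof -
  define g where "g x = (\<lambda>k\<in>K. cell (k * x))" for x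
  have "card A \<le> card (PiE K (\<lambda>_. C)) * card (bohr_set K r)"
  proof (rule card_le_image_times_fibre[where g = g])
    show "g ` A \<subseteq> PiE K (\<lambda>_. C)"
      using assms(2) by (auto simp: g_def)
    fix a assume a: "a \<in> A"
    have "(\<lambda>x. x - a) ` {x \<in> A. g x = g a} \<subseteq> bohr_set K r"
    proof clarify
      fix x assume x: "x \<in> A" "g x = g a"
      have "cell (k * x) = cell (k * a)" if "k \<in> K" for k
        using fun_cong[OF x(2), of k] that by (simp add: g_def)
      then show "x - a \<in> bohr_set K r"
        using close x(1) a by (auto simp: in_bohr_set_diff_iff)
    qed
    then have "card ((\<lambda>x. x - a) ` {x \<in> A. g x = g a}) \<le> card (bohr_set K r)"
      by (intro card_mono) auto
    then show "card {x \<in> A. g x = g a} \<le> card (bohr_set K r)"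
      by (simp add: card_image)
  qed (use assms(1) in \<open>auto intro!: finite_PiE\<close>)
  then show ?thesis
    by (simp add: card_PiE)
qed

lemma norm_cis_diff_le: "cmod (cis a - cis b) \<le> \<bar>a - b\<bar>"
proof -
  have "cis a - cis b = cis b * (cis (a - b) - 1)"
    by (simp add: cis_mult right_diff_distrib)
  then have "cmod (cis a - cis b) = 2 * \<bar>sin ((a - b) / 2)\<bar>"
    using dist_exp_i_1[of "a - b"] by (simp add: norm_mult cis_conv_exp)
  also have "\<dots> \<le> \<bar>a - b\<bar>"
    using abs_sin_x_le_abs_x[of "(a - b) / 2"] by simp
  finally show ?thesis .
qed

lemma abs_diff_lt_of_floor_eq:
  fixes a b c :: real
  assumes "\<lfloor>a\<rfloor> = \<lfloor>b\<rfloor>" shows "\<bar>a - b\<bar> < 1"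
  using assms by linarith

text \<open>The cells are \<open>M\<close> equal arcs of the circle; a chord within one is at most
  as long as the arc, \<open>2 * pi / M\<close>.\<close>

lemma card_UNIV_le_bohr_set:
  fixes K :: "'n::finite mod_ring set"
  assumes "0 < M" "2 * pi / real M \<le> r"
  shows "CARD('n) \<le> M ^ card K * card (bohr_set K r)"
proof -
  define t where "t x = real M * real_of_int (to_int_mod_ring x) / real CARD('n)" for x :: "'n mod_ring"
  have "card (UNIV :: 'n mod_ring set) \<le> card {0..<int M} ^ card K * card (bohr_set K r)"
  proof (rule card_le_bohr_set_cells[where cell = "\<lambda>x. \<lfloor>t x\<rfloor>"])
    fix x k :: "'n mod_ring"
    have "0 \<le> to_int_mod_ring (k * x)" "to_int_mod_ring (k * x) < int CARD('n)"
      using range_to_int_mod_ring[where 'a='n] by (metis atLeastLessThan_iff rangeI)+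
    then have "0 \<le> t (k * x)" "t (k * x) < real M"
      using assms(1) by (auto simp: t_def divide_simps)
    then show "\<lfloor>t (k * x)\<rfloor> \<in> {0..<int M}"
      by (simp add: floor_less_iff)
  next
    fix x y k :: "'n mod_ring"
    assume "\<lfloor>t (k * x)\<rfloor> = \<lfloor>t (k * y)\<rfloor>"
    then have lt: "\<bar>t (k * x) - t (k * y)\<bar> < 1"
      by (rule abs_diff_lt_of_floor_eq)
    have eq: "omega_pow z = cis (2 * pi / real M * t z)" for z :: "'n mod_ring"
      using assms(1) by (simp add: omega_pow_cis t_def field_simps)
    have "cmod (omega_pow (k * x) - omega_pow (k * y)) \<le> \<bar>2 * pi / real M * t (k * x) - 2 * pi / real M * t (k * y)\<bar>"
      unfolding eq by (rule norm_cis_diff_le)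
    also have "\<dots> = 2 * pi / real M * \<bar>t (k * x) - t (k * y)\<bar>"
      unfolding right_diff_distrib[symmetric] abs_mult by simp
    also have "\<dots> \<le> 2 * pi / real M * 1"
      using lt by (intro mult_left_mono) auto
    finally show "cmod (omega_pow (k * x) - omega_pow (k * y)) \<le> r"
      using assms(2) by simp
  qed auto
  then show ?thesis
    by simp
qed

text \<open>Clipping puts the right endpoint 6 into the last cell, so that six cells of length 1
  cover a closed interval of length 6.\<close>

lemma abs_diff_le_of_clipped_floor_eq:
  fixes a b :: real
  assumes "a \<le> 6" "b \<le> 6" "min 5 \<lfloor>a\<rfloor> = min 5 \<lfloor>b\<rfloor>"
  shows "\<bar>a - b\<bar> \<le> 1"
  using assms by (cases "5 \<le> \<lfloor>a\<rfloor>"; cases "5 \<le> \<lfloor>b\<rfloor>"; simp add: min_def; linarith)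

lemma bohr_set_doubling:
  fixes K :: "'n::finite mod_ring set"
  assumes r: "0 < r"
  shows "card (bohr_set K (2 * r)) \<le> 36 ^ card K * card (bohr_set K r)"
proof -
  \<comment> \<open>Squares of side \<open>4 r / 6\<close> cover the bounding square of the disc of radius \<open>2 r\<close>; the diagonal
    of such a square is less than \<open>r\<close>. The seventh value of the floor is excluded by the
    clipping with \<open>min\<close>.\<close>
  define c where "c z = min 5 \<lfloor>3 / 2 * (z / r + 2)\<rfloor>" for z :: real
  have c_range: "c z \<in> {0..<6}" if "\<bar>z\<bar> \<le> 2 * r" for z
  proof -
    have "- 2 \<le> z / r"
      using that r by (simp add: field_simps)
    then show ?thesis
      by (auto simp: c_def)
  qed
  have c_close: "\<bar>z - w\<bar> \<le> 2 / 3 * r" if "c z = c w" "\<bar>z\<bar> \<le> 2 * r" "\<bar>w\<bar> \<le> 2 * r" for z w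
  proof -
    have "3 / 2 * (z / r + 2) \<le> 6" "3 / 2 * (w / r + 2) \<le> 6"
      using that r by (auto simp: field_simps)
    moreover have "min 5 \<lfloor>3 / 2 * (z / r + 2)\<rfloor> = min 5 \<lfloor>3 / 2 * (w / r + 2)\<rfloor>"
      using that(1) by (simp only: c_def)
    ultimately have "\<bar>3 / 2 * (z / r + 2) - 3 / 2 * (w / r + 2)\<bar> \<le> 1"
      by (rule abs_diff_le_of_clipped_floor_eq)
    moreover have "3 / 2 * (z / r + 2) - 3 / 2 * (w / r + 2) = 3 / 2 * ((z - w) / r)"
      unfolding diff_divide_distrib right_diff_distrib distrib_left by simp
    ultimately have "\<bar>3 / 2 * ((z - w) / r)\<bar> \<le> 1"
      by (simp only:)
    then have "3 / 2 * (\<bar>z - w\<bar> / r) \<le> 1"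
      using r by (simp only: abs_mult abs_divide abs_of_pos abs_numeral)
    then have "\<bar>z - w\<bar> / r \<le> 2 / 3"
      by linarith
    then show ?thesis
      using r by (simp add: pos_divide_le_eq)
  qed
  have "card (bohr_set K (2 * r)) \<le> card ({0..<6::int} \<times> {0..<6::int}) ^ card K * card (bohr_set K r)"
  proof (rule card_le_bohr_set_cells[where cell = "\<lambda>x. (c (Re (omega_pow x - 1)), c (Im (omega_pow x - 1)))"])
    fix x k assume "x \<in> bohr_set K (2 * r)" "k \<in> K"
    then have "cmod (omega_pow (k * x) - 1) \<le> 2 * r"
      by (simp add: bohr_set_def)
    then have "\<bar>Re (omega_pow (k * x) - 1)\<bar> \<le> 2 * r" "\<bar>Im (omega_pow (k * x) - 1)\<bar> \<le> 2 * r"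
      using abs_Re_le_cmod abs_Im_le_cmod order_trans by blast+
    then show "(c (Re (omega_pow (k * x) - 1)), c (Im (omega_pow (k * x) - 1))) \<in> {0..<6} \<times> {0..<6}"
      using c_range by simp
  next
    fix x y k
    assume xy: "x \<in> bohr_set K (2 * r)" "y \<in> bohr_set K (2 * r)" "k \<in> K"
      and eq: "(c (Re (omega_pow (k * x) - 1)), c (Im (omega_pow (k * x) - 1)))
        = (c (Re (omega_pow (k * y) - 1)), c (Im (omega_pow (k * y) - 1)))"
    define z w where "z = omega_pow (k * x) - 1" and "w = omega_pow (k * y) - 1"
    have "cmod z \<le> 2 * r" "cmod w \<le> 2 * r"
      using xy by (auto simp: bohr_set_def z_def w_def)
    then have "\<bar>Re z\<bar> \<le> 2 * r" "\<bar>Im z\<bar> \<le> 2 * r" "\<bar>Re w\<bar> \<le> 2 * r" "\<bar>Im w\<bar> \<le> 2 * r"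
      using abs_Re_le_cmod abs_Im_le_cmod order_trans by blast+
    moreover have "c (Re z) = c (Re w)" "c (Im z) = c (Im w)"
      using eq unfolding z_def w_def by blast+
    ultimately have d: "\<bar>Re (z - w)\<bar> \<le> 2 / 3 * r" "\<bar>Im (z - w)\<bar> \<le> 2 / 3 * r"
      by (simp_all only: minus_complex.sel c_close)
    have "(cmod (z - w))\<^sup>2 = \<bar>Re (z - w)\<bar>\<^sup>2 + \<bar>Im (z - w)\<bar>\<^sup>2"
      by (simp add: cmod_power2)
    also have "\<dots> \<le> (2 / 3 * r)\<^sup>2 + (2 / 3 * r)\<^sup>2"
      using d by (intro add_mono power_mono) auto
    also have "\<dots> \<le> r\<^sup>2"
      by (simp add: power2_eq_square field_simps)
    finally have "cmod (z - w) \<le> r"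
      using r by (simp add: power2_le_iff_abs_le abs_le_square_iff)
    then show "cmod (omega_pow (k * x) - omega_pow (k * y)) \<le> r"
      by (simp add: z_def w_def)
  qed simp
  then show ?thesis
    by simp
qed

text \<open>Between \<open>r\<close> and \<open>2 * r\<close> there are \<open>J\<close> steps of
  length \<open>r / J\<close>. If each added more than the stated proportion, the increments would
  sum to more than the doubling bound allows. This replaces regularity at the small scale, since
  regularity is assumed only at the radius of the base.\<close>

lemma exists_stable_radius:
  fixes K :: "'n::finite mod_ring set"
  assumes r: "0 < r" and J: "0 < J"
  shows "\<exists>s. r \<le> s \<and> s \<le> 2 * r \<and>
    real (card (bohr_set K s)) - real (card (bohr_set K (s - r / real J)))
      \<le> 36 ^ card K / real J * real (card (bohr_set K s))"
proof -
  define s where "s j = r + real j * (r / real J)" for j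
  define b where "b j = real (card (bohr_set K (s j)))" for j
  have bmono: "b i \<le> b j" if "i \<le> j" for i j
    using that r unfolding b_def s_def
    by (auto intro!: card_mono bohr_set_mono divide_right_mono mult_right_mono)
  have bJ: "b J \<le> 36 ^ card K * b 0"
  proof -
    have "real (card (bohr_set K (2 * r))) \<le> real (36 ^ card K * card (bohr_set K r))"
      using bohr_set_doubling[OF r] of_nat_le_iff by blast
    then show ?thesis
      using J by (simp add: b_def s_def)
  qed
  have "\<exists>j<J. b (Suc j) - b j \<le> 36 ^ card K / real J * b (Suc j)"
  proof (rule ccontr)
    assume "\<not> ?thesis"
    \<comment> \<open>Passing from \<open>b (Suc j)\<close> to the smaller \<open>b 0\<close> gives
      all increments one common lower bound, to be compared with the telescoping sum.\<close>
    then have *: "36 ^ card K / real J * b 0 < b (Suc j) - b j" if "j < J" for j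
      using that bmono[of 0 "Suc j"] mult_left_mono[of "b 0" "b (Suc j)" "36 ^ card K / real J"]
      by (fastforce simp: not_le)
    have "(\<Sum>j<J. 36 ^ card K / real J * b 0) < (\<Sum>j<J. b (Suc j) - b j)"
      using J * by (intro sum_strict_mono) auto
    then have "36 ^ card K * b 0 < b J - b 0"
      using J by (simp add: sum_lessThan_telescope)
    moreover have "0 \<le> b 0"
      by (simp add: b_def)
    ultimately show False
      using bJ by linarith
  qed
  then obtain j where j: "j < J" "b (Suc j) - b j \<le> 36 ^ card K / real J * b (Suc j)"
    by blast
  have "s (Suc j) - r / real J = s j"
    by (simp add: s_def algebra_simps add_divide_distrib)
  moreover have "s (Suc j) \<le> 2 * r"
  proof -
    have "real (Suc j) * (r / real J) \<le> real J * (r / real J)"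
      using j r by (intro mult_right_mono) auto
    then show ?thesis
      using J by (simp add: s_def)
  qed
  moreover have "r \<le> s (Suc j)"
    using r by (simp add: s_def)
  ultimately show ?thesis
    using j(2) unfolding b_def by metis
qed

section \<open>The \<open>U\<^sup>2\<close> norm\<close>

lemma norm_sum_mult_le:
  fixes f g :: "'a \<Rightarrow> complex"
  shows "(cmod (\<Sum>i\<in>I. f i * g i))\<^sup>2 \<le> (\<Sum>i\<in>I. (cmod (f i))\<^sup>2) * (\<Sum>i\<in>I. (cmod (g i))\<^sup>2)"
proof -
  have "cmod (\<Sum>i\<in>I. f i * g i) \<le> (\<Sum>i\<in>I. cmod (f i) * cmod (g i))"
    by (rule order_trans[OF norm_sum]) (simp add: norm_mult)
  then have "(cmod (\<Sum>i\<in>I. f i * g i))\<^sup>2 \<le> (\<Sum>i\<in>I. cmod (f i) * cmod (g i))\<^sup>2"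
    by (intro power_mono) auto
  also have "\<dots> \<le> (\<Sum>i\<in>I. (cmod (f i))\<^sup>2) * (\<Sum>i\<in>I. (cmod (g i))\<^sup>2)"
    by (rule Cauchy_Schwarz_ineq_sum)
  finally show ?thesis .
qed

lemma norm_sum_unit_mult_le:
  fixes f g :: "'a \<Rightarrow> complex"
  assumes "\<And>i. i \<in> I \<Longrightarrow> cmod (f i) \<le> 1"
  shows "(cmod (\<Sum>i\<in>I. f i * g i))\<^sup>2 \<le> real (card I) * (\<Sum>i\<in>I. (cmod (g i))\<^sup>2)"
proof -
  have "(\<Sum>i\<in>I. (cmod (f i))\<^sup>2) \<le> (\<Sum>i\<in>I. 1)"
    using assms by (intro sum_mono) (simp add: power_le_one)
  then show ?thesis
    by (intro order_trans[OF norm_sum_mult_le] mult_right_mono) (auto intro: sum_nonneg)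
qed

lemma sum_square_le:
  fixes f :: "'a \<Rightarrow> real"
  shows "(\<Sum>i\<in>I. f i)\<^sup>2 \<le> real (card I) * (\<Sum>i\<in>I. (f i)\<^sup>2)"
  using Cauchy_Schwarz_ineq_sum[of "\<lambda>_. 1" f I] by simp

lemma norm_sum_squared:
  fixes f :: "'a \<Rightarrow> complex"
  shows "of_real ((cmod (\<Sum>i\<in>I. f i))\<^sup>2) = (\<Sum>i\<in>I. \<Sum>j\<in>I. f i * cnj (f j))"
  by (simp only: complex_norm_square cnj_sum sum_product)

lemma sum_UNIV_shift: "(\<Sum>x\<in>UNIV. f (x + c)) = (\<Sum>x\<in>UNIV. f (x :: 'a :: {finite, ab_group_add}))"
  by (rule sum.reindex_bij_witness[where i = "\<lambda>x. x - c" and j = "\<lambda>x. x + c"]) auto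

text \<open>Unnormalised autocorrelation. Its squared moduli sum to \<open>N ^ 3\<close> times the
  fourth power of the \<open>U\<^sup>2\<close> norm, a form in which the triple average is visibly
  real and nonnegative.\<close>

definition autocorr :: "('n::finite mod_ring \<Rightarrow> complex) \<Rightarrow> 'n mod_ring \<Rightarrow> complex" where
  "autocorr f a = (\<Sum>x\<in>UNIV. f x * cnj (f (x + a)))"

text \<open>For fixed \<open>a\<close>, the substitution \<open>y = x + b\<close> separates the sums
  over \<open>x\<close> and \<open>b\<close> into an autocorrelation and its conjugate.\<close>

lemma U2_sum_eq_autocorr:
  "(\<Sum>x\<in>UNIV. \<Sum>a\<in>UNIV. \<Sum>b\<in>UNIV. f x * cnj (f (x + a) * f (x + b)) * f (x + a + b))
    = of_real (\<Sum>a\<in>UNIV. (cmod (autocorr f a))\<^sup>2)"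
proof -
  have inner: "(\<Sum>b\<in>UNIV. cnj (f (x + b)) * f (x + a + b)) = cnj (autocorr f a)" for x a
  proof -
    have "(\<Sum>b\<in>UNIV. cnj (f (x + b)) * f (x + a + b)) = (\<Sum>b\<in>UNIV. cnj (f (b + x)) * f (b + x + a))"
      by (simp add: ac_simps)
    also have "\<dots> = (\<Sum>y\<in>UNIV. cnj (f y) * f (y + a))"
      by (rule sum_UNIV_shift)
    finally show ?thesis
      by (simp add: autocorr_def)
  qed
  have "(\<Sum>x\<in>UNIV. \<Sum>a\<in>UNIV. \<Sum>b\<in>UNIV. f x * cnj (f (x + a) * f (x + b)) * f (x + a + b))
      = (\<Sum>x\<in>UNIV. \<Sum>a\<in>UNIV. f x * cnj (f (x + a)) * (\<Sum>b\<in>UNIV. cnj (f (x + b)) * f (x + a + b)))"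
    by (simp add: sum_distrib_left mult.assoc)
  also have "\<dots> = (\<Sum>a\<in>UNIV. \<Sum>x\<in>UNIV. f x * cnj (f (x + a)) * cnj (autocorr f a))"
    unfolding inner by (rule sum.swap)
  also have "\<dots> = (\<Sum>a\<in>UNIV. autocorr f a * cnj (autocorr f a))"
    by (simp add: autocorr_def sum_distrib_right)
  finally show ?thesis
    by (simp only: complex_norm_square of_real_sum)
qed

lemma U2_norm_eq_root:
  "U2_norm (f :: 'n::finite mod_ring \<Rightarrow> complex) = root 4 ((\<Sum>a\<in>UNIV. (cmod (autocorr f a))\<^sup>2) / real CARD('n) ^ 3)"
proof -
  have "expect UNIV (\<lambda>x. expect UNIV (\<lambda>a. expect UNIV (\<lambda>b.
      f x * cnj (f (x + a) * f (x + b)) * f (x + a + b))))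
    = (\<Sum>x\<in>UNIV. \<Sum>a\<in>UNIV. \<Sum>b\<in>UNIV. f x * cnj (f (x + a) * f (x + b)) * f (x + a + b))
      / of_nat CARD('n) ^ 3"
    unfolding expect_def by (simp add: power3_eq_cube flip: sum_divide_distrib)
  also have "\<dots> = of_real ((\<Sum>a\<in>UNIV. (cmod (autocorr f a))\<^sup>2) / real CARD('n) ^ 3)"
    unfolding U2_sum_eq_autocorr by simp
  finally show ?thesis
    unfolding U2_norm_def by (simp only: Re_complex_of_real)
qed

lemma U2_norm_nonneg: "0 \<le> U2_norm f"
  by (simp add: U2_norm_eq_root sum_nonneg)

lemma sum_autocorr: "(\<Sum>a\<in>UNIV. (cmod (autocorr f a))\<^sup>2) = real CARD('n) ^ 3 * U2_norm f ^ 4"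
  for f :: "'n::finite mod_ring \<Rightarrow> complex"
  by (simp add: U2_norm_eq_root sum_nonneg)

text \<open>Cauchy-Schwarz over \<open>h\<close> removes \<open>a\<close>. After expanding the
  square, the factors \<open>b\<close> are bounded trivially, and Cauchy-Schwarz over the pairs
  \<open>(k, k')\<close> produces squared autocorrelations of \<open>g\<close>.\<close>

lemma bilinear_form_le_U2_norm:
  fixes g :: "'n::finite mod_ring \<Rightarrow> complex"
  assumes a: "\<And>h. h \<in> H \<Longrightarrow> cmod (a h) \<le> 1" and b: "\<And>k. k \<in> L \<Longrightarrow> cmod (b k) \<le> 1"
  shows "cmod (\<Sum>h\<in>H. \<Sum>k\<in>L. a h * b k * cnj (g (w + h + k)))
    \<le> sqrt (real (card H) * real (card L)) * (real CARD('n) * U2_norm g)"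
proof -
  define X where "X h = (\<Sum>k\<in>L. b k * cnj (g (w + h + k)))" for h
  \<comment> \<open>The sum runs over the whole group instead of \<open>H\<close>: this can only
    enlarge it and makes the inner sum over \<open>h\<close> a full autocorrelation.\<close>
  define E where "E = (\<Sum>h\<in>UNIV. (cmod (X h))\<^sup>2)"
  let ?N = "real CARD('n)"
  have corr: "(\<Sum>h\<in>UNIV. cnj (g (w + h + k)) * g (w + h + k')) = cnj (autocorr g (k' - k))" for k k'
  proof -
    have "(\<Sum>h\<in>UNIV. cnj (g (w + h + k)) * g (w + h + k'))
        = (\<Sum>h\<in>UNIV. cnj (g (h + (w + k))) * g (h + (w + k) + (k' - k)))"
      by (simp add: algebra_simps)
    also have "\<dots> = (\<Sum>x\<in>UNIV. cnj (g x) * g (x + (k' - k)))"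
      by (rule sum_UNIV_shift)
    finally show ?thesis
      by (simp add: autocorr_def)
  qed
  have "of_real E = (\<Sum>h\<in>UNIV. \<Sum>k\<in>L. \<Sum>k'\<in>L. b k * cnj (b k') * (cnj (g (w + h + k)) * g (w + h + k')))"
    unfolding E_def X_def of_real_sum norm_sum_squared by (simp add: ac_simps)
  also have "\<dots> = (\<Sum>k\<in>L. \<Sum>k'\<in>L. \<Sum>h\<in>UNIV. b k * cnj (b k') * (cnj (g (w + h + k)) * g (w + h + k')))"
    by (subst sum.swap, rule sum.cong[OF refl], rule sum.swap)
  also have "\<dots> = (\<Sum>k\<in>L. \<Sum>k'\<in>L. b k * cnj (b k') * cnj (autocorr g (k' - k)))"
    by (simp add: corr flip: sum_distrib_left)
  finally have "cmod (of_real E) = cmod (\<Sum>k\<in>L. \<Sum>k'\<in>L. b k * cnj (b k') * cnj (autocorr g (k' - k)))"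
    by (rule arg_cong)
  moreover have "0 \<le> E"
    by (simp add: E_def sum_nonneg)
  ultimately have "E = cmod (\<Sum>k\<in>L. \<Sum>k'\<in>L. b k * cnj (b k') * cnj (autocorr g (k' - k)))"
    by simp
  also have "\<dots> \<le> (\<Sum>k\<in>L. \<Sum>k'\<in>L. cmod (autocorr g (k' - k)))"
  proof (intro sum_norm_le)
    fix k k' assume kk: "k \<in> L" "k' \<in> L"
    have "cmod (b k) * cmod (b k') \<le> 1"
      using b[OF kk(1)] b[OF kk(2)] by (simp add: mult_le_one)
    then show "cmod (b k * cnj (b k') * cnj (autocorr g (k' - k))) \<le> cmod (autocorr g (k' - k))"
      by (simp add: norm_mult mult_left_le_one_le)
  qed
  finally have "E \<le> (\<Sum>p\<in>L \<times> L. cmod (autocorr g (snd p - fst p)))"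
    by (simp add: sum.cartesian_product case_prod_beta)
  then have E2: "E\<^sup>2 \<le> (\<Sum>p\<in>L \<times> L. cmod (autocorr g (snd p - fst p)))\<^sup>2"
    by (intro power_mono) (auto simp: E_def sum_nonneg)
  have "(\<Sum>p\<in>L \<times> L. cmod (autocorr g (snd p - fst p)))\<^sup>2
      \<le> real (card (L \<times> L)) * (\<Sum>p\<in>L \<times> L. (cmod (autocorr g (snd p - fst p)))\<^sup>2)"
    by (rule sum_square_le)
  note E2 = order_trans[OF E2 this]
  have "(\<Sum>p\<in>L \<times> L. (cmod (autocorr g (snd p - fst p)))\<^sup>2)
      = (\<Sum>k\<in>L. \<Sum>k'\<in>L. (cmod (autocorr g (k' - k)))\<^sup>2)"
    by (simp add: sum.cartesian_product case_prod_beta)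
  also have "\<dots> \<le> (\<Sum>k\<in>UNIV. \<Sum>k'\<in>UNIV. (cmod (autocorr g (k' - k)))\<^sup>2)"
    by (intro order_trans[OF sum_mono2[of UNIV L]] sum_mono sum_mono2 sum_nonneg) auto
  also have "\<dots> = (\<Sum>k\<in>(UNIV :: 'n mod_ring set). ?N ^ 3 * U2_norm g ^ 4)"
    using sum_UNIV_shift[of "\<lambda>x. (cmod (autocorr g x))\<^sup>2" "- k" for k]
    by (simp add: sum_autocorr)
  finally have "real (card (L \<times> L)) * (\<Sum>p\<in>L \<times> L. (cmod (autocorr g (snd p - fst p)))\<^sup>2)
      \<le> real (card (L \<times> L)) * (\<Sum>k\<in>(UNIV :: 'n mod_ring set). ?N ^ 3 * U2_norm g ^ 4)"
    by (intro mult_left_mono) auto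
  note E2 = order_trans[OF E2 this]
  also have "real (card (L \<times> L)) * (\<Sum>k\<in>(UNIV :: 'n mod_ring set). ?N ^ 3 * U2_norm g ^ 4)
      = (real (card L) * (?N * U2_norm g)\<^sup>2)\<^sup>2"
    by (simp add: card_cartesian_product power2_eq_square power4_eq_xxxx power3_eq_cube)
  finally have E: "E \<le> real (card L) * (?N * U2_norm g)\<^sup>2"
    by (rule power2_le_imp_le) (intro mult_nonneg_nonneg, auto)
  have "(\<Sum>h\<in>H. \<Sum>k\<in>L. a h * b k * cnj (g (w + h + k))) = (\<Sum>h\<in>H. a h * X h)"
    by (simp add: X_def sum_distrib_left mult.assoc)
  then have "(cmod (\<Sum>h\<in>H. \<Sum>k\<in>L. a h * b k * cnj (g (w + h + k))))\<^sup>2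
      \<le> real (card H) * (\<Sum>h\<in>H. (cmod (X h))\<^sup>2)"
    using norm_sum_unit_mult_le[of H a X] a by simp
  also have "\<dots> \<le> real (card H) * E"
    unfolding E_def by (intro mult_left_mono sum_mono2) auto
  also have "\<dots> \<le> real (card H) * (real (card L) * (?N * U2_norm g)\<^sup>2)"
    using E by (intro mult_left_mono) auto
  also have "\<dots> = (sqrt (real (card H) * real (card L)) * (?N * U2_norm g))\<^sup>2"
    by (simp add: power_mult_distrib)
  finally show ?thesis
    by (rule power2_le_imp_le) (simp add: U2_norm_nonneg)
qed

section \<open>Fourier analysis of the \<open>U\<^sup>2\<close> norm\<close>

lemma parseval:
  fixes F :: "'n::finite mod_ring \<Rightarrow> complex"
  shows "(\<Sum>r\<in>UNIV. (cmod (\<Sum>x\<in>UNIV. F x * omega_pow (r * x)))\<^sup>2) = real CARD('n) * (\<Sum>x\<in>UNIV. (cmod (F x))\<^sup>2)"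
proof -
  have "of_real (\<Sum>r\<in>UNIV. (cmod (\<Sum>x\<in>UNIV. F x * omega_pow (r * x)))\<^sup>2)
      = (\<Sum>r\<in>UNIV. \<Sum>x\<in>UNIV. \<Sum>y\<in>UNIV. F x * cnj (F y) * omega_pow (r * (x - y)))"
    unfolding of_real_sum norm_sum_squared by (simp add: right_diff_distrib omega_pow_diff ac_simps)
  also have "\<dots> = (\<Sum>x\<in>UNIV. \<Sum>y\<in>UNIV. \<Sum>r\<in>UNIV. F x * cnj (F y) * omega_pow (r * (x - y)))"
    by (subst sum.swap, rule sum.cong[OF refl], rule sum.swap)
  also have "\<dots> = (\<Sum>x\<in>UNIV. \<Sum>y\<in>UNIV. if y = x then F x * cnj (F x) * of_nat CARD('n) else 0)"
    by (intro sum.cong refl) (simp add: sum_omega_pow_mult flip: sum_distrib_left)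
  also have "\<dots> = of_real (real CARD('n) * (\<Sum>x\<in>UNIV. (cmod (F x))\<^sup>2))"
    by (simp only: sum.delta[OF finite] sum_distrib_left complex_norm_square of_real_sum of_real_mult of_real_of_nat_eq UNIV_I if_True mult.commute)
  finally show ?thesis
    by (simp only: of_real_eq_iff)
qed

text \<open>With normalised Fourier coefficients, the fourth power of the norm is the sum of their
  fourth powers. Two of the four factors are bounded by \<open>M\<close>, and the remaining sum of
  squares is at most 1 by Parseval.\<close>

lemma U2_norm_le_Fourier:
  fixes f :: "'n::finite mod_ring \<Rightarrow> complex"
  assumes f: "\<And>x. cmod (f x) \<le> 1"
    and M: "\<And>r. cmod (\<Sum>x\<in>UNIV. f x * omega_pow (r * x)) \<le> real CARD('n) * M"
  shows "U2_norm f ^ 4 \<le> M\<^sup>2"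
proof -
  let ?N = "real CARD('n)"
  define F where "F r = (\<Sum>x\<in>UNIV. f x * omega_pow (r * x))" for r
  \<comment> \<open>The autocorrelation is a convolution of \<open>f\<close> with its own reflected
    conjugate, so its transform is a squared modulus.\<close>
  have square: "cmod (\<Sum>a\<in>UNIV. cnj (autocorr f a) * omega_pow (r * a)) = (cmod (F r))\<^sup>2" for r
  proof -
    have "of_real ((cmod (F r))\<^sup>2) = (\<Sum>x\<in>UNIV. \<Sum>y\<in>UNIV. f x * cnj (f y) * omega_pow (r * (x - y)))"
      unfolding F_def norm_sum_squared by (simp add: right_diff_distrib omega_pow_diff ac_simps)
    also have "\<dots> = (\<Sum>x\<in>UNIV. \<Sum>a\<in>UNIV. f x * cnj (f (x + a)) * cnj (omega_pow (r * a)))"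
    proof (rule sum.cong[OF refl])
      fix x
      show "(\<Sum>y\<in>UNIV. f x * cnj (f y) * omega_pow (r * (x - y)))
          = (\<Sum>a\<in>UNIV. f x * cnj (f (x + a)) * cnj (omega_pow (r * a)))"
        by (rule sum.reindex_bij_witness[where i = "\<lambda>a. x + a" and j = "\<lambda>y. y - x"])
          (auto simp flip: omega_pow_uminus mult_minus_right)
    qed
    also have "\<dots> = (\<Sum>a\<in>UNIV. autocorr f a * cnj (omega_pow (r * a)))"
      by (subst sum.swap) (simp add: autocorr_def sum_distrib_right)
    also have "\<dots> = cnj (\<Sum>a\<in>UNIV. cnj (autocorr f a) * omega_pow (r * a))"
      by simp
    finally show ?thesis
      by (metis complex_mod_cnj norm_of_real abs_of_nonneg zero_le_power2)
  qed
  have "?N * (\<Sum>a\<in>UNIV. (cmod (autocorr f a))\<^sup>2) = (\<Sum>r\<in>UNIV. ((cmod (F r))\<^sup>2)\<^sup>2)"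
    using parseval[of "\<lambda>a. cnj (autocorr f a)"] by (simp add: square)
  also have "\<dots> \<le> (\<Sum>r\<in>UNIV. (?N * M)\<^sup>2 * (cmod (F r))\<^sup>2)"
  proof (rule sum_mono)
    fix r
    have "(cmod (F r))\<^sup>2 \<le> (?N * M)\<^sup>2"
      using M[of r] by (intro power_mono) (auto simp: F_def)
    then show "((cmod (F r))\<^sup>2)\<^sup>2 \<le> (?N * M)\<^sup>2 * (cmod (F r))\<^sup>2"
      unfolding power2_eq_square[of "(cmod (F r))\<^sup>2"] by (intro mult_right_mono) auto
  qed
  also have "\<dots> = (?N * M)\<^sup>2 * (?N * (\<Sum>x\<in>UNIV. (cmod (f x))\<^sup>2))"
    by (simp add: F_def parseval flip: sum_distrib_left)
  also have "\<dots> \<le> (?N * M)\<^sup>2 * (?N * ?N)"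
  proof -
    have "(\<Sum>x\<in>UNIV. (cmod (f x))\<^sup>2) \<le> (\<Sum>x\<in>(UNIV :: 'n mod_ring set). 1)"
      using f by (intro sum_mono) (simp add: power_le_one)
    then show ?thesis
      by (intro mult_left_mono) auto
  qed
  finally have "?N ^ 4 * U2_norm f ^ 4 \<le> ?N ^ 4 * M\<^sup>2"
    unfolding sum_autocorr by (simp only: power2_eq_square power3_eq_cube power4_eq_xxxx ac_simps)
  then show ?thesis
    by simp
qed

section \<open>Upper bounds for the dual norm\<close>

lemma U2_dual_norm_le:
  assumes "\<And>g. U2_norm g \<le> 1 \<Longrightarrow> cmod (inner_avg f g) \<le> C"
  shows "U2_dual_norm (f :: 'n::finite mod_ring \<Rightarrow> complex) \<le> C"
proof -
  \<comment> \<open>The zero function shows that the supremum is over a nonempty set, as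
    \<open>cSup_least\<close> demands.\<close>
  have "U2_norm (\<lambda>_ :: 'n mod_ring. 0) \<le> 1"
    by (simp add: U2_norm_def expect_def)
  then show ?thesis
    unfolding U2_dual_norm_def using assms by (intro cSup_least) auto
qed

lemma sum_swap_inner:
  "(\<Sum>y\<in>Z. \<Sum>h\<in>H. \<Sum>k\<in>L. f h k y) = (\<Sum>h\<in>H. \<Sum>k\<in>L. \<Sum>y\<in>Z. f h k y)"
  by (subst sum.swap, rule sum.cong[OF refl], rule sum.swap)

lemma sum_swap_innermost:
  "(\<Sum>z\<in>Z. \<Sum>t\<in>T. \<Sum>h\<in>H. \<Sum>k\<in>L. f z t h k) = (\<Sum>t\<in>T. \<Sum>h\<in>H. \<Sum>k\<in>L. \<Sum>z\<in>Z. f z t h k)"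
  by (subst sum.swap, rule sum.cong[OF refl], rule sum_swap_inner)

text \<open>In the pairing with \<open>g\<close>, the substitution
  \<open>y = z - w t - h - k\<close> leaves, for each \<open>t\<close> and \<open>y\<close>, a sum
  of the kind bounded by \<open>bilinear_form_le_U2_norm\<close>. Later \<open>t\<close> pairs the
  index of an average with a point of the base. The separate constant \<open>c\<close> allows
  normalising by the full base while \<open>T\<close> uses a smaller Bohr set.\<close>

lemma U2_dual_norm_bilinear_average:
  fixes a b :: "'t \<Rightarrow> 'n::finite mod_ring \<Rightarrow> 'n mod_ring \<Rightarrow> complex" and w :: "'t \<Rightarrow> 'n mod_ring"
  assumes T: "real (card T) \<le> c" and c: "0 < c" and "H \<noteq> {}" "L \<noteq> {}"
    and a: "\<And>t y h. t \<in> T \<Longrightarrow> h \<in> H \<Longrightarrow> cmod (a t y h) \<le> 1"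
    and b: "\<And>t y k. t \<in> T \<Longrightarrow> k \<in> L \<Longrightarrow> cmod (b t y k) \<le> 1"
  shows "U2_dual_norm (\<lambda>z. (\<Sum>t\<in>T. \<Sum>h\<in>H. \<Sum>k\<in>L. a t (z - w t - h - k) h * b t (z - w t - h - k) k)
      / of_real (c * real (card H) * real (card L)))
    \<le> real CARD('n) / sqrt (real (card H) * real (card L))"
proof (rule U2_dual_norm_le)
  fix g :: "'n mod_ring \<Rightarrow> complex" assume g: "U2_norm g \<le> 1"
  let ?N = "real CARD('n)" and ?m = "real (card H) * real (card L)"
  have m: "0 < ?m"
    using assms by (simp add: card_gt_0_iff)
  define S where "S t y = (\<Sum>h\<in>H. \<Sum>k\<in>L. a t y h * b t y k * cnj (g (y + w t + h + k)))" for t y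
  have S: "cmod (S t y) \<le> sqrt ?m * ?N" if "t \<in> T" for t y
  proof -
    have "cmod (S t y) \<le> sqrt ?m * (?N * U2_norm g)"
      unfolding S_def using that by (intro bilinear_form_le_U2_norm a b)
    also have "\<dots> \<le> sqrt ?m * (?N * 1)"
      using g by (intro mult_left_mono) auto
    finally show ?thesis
      by simp
  qed
  have "(\<Sum>z\<in>UNIV. (\<Sum>t\<in>T. \<Sum>h\<in>H. \<Sum>k\<in>L. a t (z - w t - h - k) h * b t (z - w t - h - k) k) * cnj (g z))
      = (\<Sum>t\<in>T. \<Sum>h\<in>H. \<Sum>k\<in>L. \<Sum>z\<in>UNIV. a t (z - w t - h - k) h * b t (z - w t - h - k) k * cnj (g z))"
    unfolding sum_distrib_right by (rule sum_swap_innermost)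
  also have "\<dots> = (\<Sum>t\<in>T. \<Sum>h\<in>H. \<Sum>k\<in>L. \<Sum>y\<in>UNIV. a t y h * b t y k * cnj (g (y + w t + h + k)))"
  proof -
    have "(\<Sum>z\<in>UNIV. a t (z - w t - h - k) h * b t (z - w t - h - k) k * cnj (g z))
        = (\<Sum>y\<in>UNIV. a t y h * b t y k * cnj (g (y + w t + h + k)))" for t h k
      by (rule sum.reindex_bij_witness[where i = "\<lambda>y. y + w t + h + k" and j = "\<lambda>z. z - w t - h - k"])
        (auto simp: algebra_simps)
    then show ?thesis
      by simp
  qed
  also have "\<dots> = (\<Sum>t\<in>T. \<Sum>y\<in>UNIV. S t y)"
    unfolding S_def
    by (rule sum.cong[OF refl], rule sum_swap_inner[symmetric])
  finally have "inner_avg (\<lambda>z. (\<Sum>t\<in>T. \<Sum>h\<in>H. \<Sum>k\<in>L. a t (z - w t - h - k) h * b t (z - w t - h - k) k)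
      / of_real (c * real (card H) * real (card L))) g
      = (\<Sum>t\<in>T. \<Sum>y\<in>UNIV. S t y) / of_real (c * ?m * ?N)"
    by (simp add: inner_avg_def expect_def mult.assoc flip: sum_divide_distrib)
  moreover have "cmod (\<Sum>t\<in>T. \<Sum>y\<in>UNIV. S t y) \<le> c * (?N * (sqrt ?m * ?N))"
  proof -
    have "cmod (\<Sum>t\<in>T. \<Sum>y\<in>UNIV. S t y) \<le> (\<Sum>t\<in>T. \<Sum>y\<in>(UNIV :: 'n mod_ring set). sqrt ?m * ?N)"
      using S by (intro sum_norm_le)
    also have "\<dots> = real (card T) * (?N * (sqrt ?m * ?N))"
      by simp
    also have "\<dots> \<le> c * (?N * (sqrt ?m * ?N))"
      using T by (intro mult_right_mono) auto
    finally show ?thesis .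
  qed
  ultimately have "cmod (inner_avg (\<lambda>z. (\<Sum>t\<in>T. \<Sum>h\<in>H. \<Sum>k\<in>L. a t (z - w t - h - k) h * b t (z - w t - h - k) k)
      / of_real (c * real (card H) * real (card L))) g) \<le> c * (?N * (sqrt ?m * ?N)) / (c * ?m * ?N)"
    using c m by (simp only: norm_divide norm_of_real abs_of_nonneg mult_nonneg_nonneg order.strict_implies_order
        of_nat_0_le_iff divide_right_mono)
  also have "\<dots> = ?N / sqrt ?m"
    using c m real_sqrt_mult_self[of ?m] by (simp add: divide_simps)
  finally show "cmod (inner_avg (\<lambda>z. (\<Sum>t\<in>T. \<Sum>h\<in>H. \<Sum>k\<in>L. a t (z - w t - h - k) h * b t (z - w t - h - k) k)
      / of_real (c * real (card H) * real (card L))) g) \<le> ?N / sqrt ?m" .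
qed

section \<open>Quadratic phases on regular Bohr sets\<close>

lemma norm_sum_diff_shift_le:
  fixes F :: "'n::finite mod_ring \<Rightarrow> complex"
  assumes sub: "(\<lambda>u. u + s) ` C \<subseteq> A" and F: "\<And>u. u \<in> A \<Longrightarrow> cmod (F u) \<le> 1"
  shows "cmod ((\<Sum>u\<in>A. F u) - (\<Sum>u\<in>C. F (u + s))) \<le> real (card A) - real (card C)"
proof -
  let ?C = "(\<lambda>u. u + s) ` C"
  have "(\<Sum>u\<in>C. F (u + s)) = (\<Sum>u\<in>?C. F u)"
    by (simp add: sum.reindex)
  then have "(\<Sum>u\<in>A. F u) - (\<Sum>u\<in>C. F (u + s)) = (\<Sum>u\<in>A - ?C. F u)"
    using sub by (simp add: sum_diff)
  then have "cmod ((\<Sum>u\<in>A. F u) - (\<Sum>u\<in>C. F (u + s))) \<le> (\<Sum>u\<in>A - ?C. 1)"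
    using F by (simp only:, intro sum_norm_le) auto
  also have "\<dots> = real (card A) - real (card C)"
    using sub by (simp add: card_Diff_subset card_image card_mono of_nat_diff)
      (metis card_image card_mono finite inj_on_add' of_nat_diff)
  finally show ?thesis .
qed

text \<open>The concentric set of radius \<open>R * (1 - \<epsilon>)\<close> stays inside the base
  when moved by \<open>s\<close>, and regularity bounds the number of points lost. Restricting
  \<open>u\<close> to it also keeps the shifted points in the domain of \<open>q\<close>.\<close>

lemma regular_bohr_shift:
  fixes F :: "'n::finite mod_ring \<Rightarrow> complex"
  assumes reg: "regular_bohr K R" and "0 < \<epsilon>" and s: "s \<in> bohr_set K (\<epsilon> * R)"
    and F: "\<And>u. cmod (F u) \<le> 1"
  shows "cmod ((\<Sum>u\<in>bohr_set K R. F u) - (\<Sum>u\<in>bohr_set K (R * (1 - \<epsilon>)). F (u + s)))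
    \<le> 100 * real (card K) * \<epsilon> * real (card (bohr_set K R))"
proof -
  have "(\<lambda>u. u + s) ` bohr_set K (R * (1 - \<epsilon>)) \<subseteq> bohr_set K R"
  proof clarify
    fix u assume "u \<in> bohr_set K (R * (1 - \<epsilon>))"
    from bohr_set_add[OF this s] show "u + s \<in> bohr_set K R"
      by (simp add: algebra_simps)
  qed
  note norm_sum_diff_shift_le[OF this F]
  moreover have "real (card (bohr_set K R)) * (1 - 100 * real (card K) * \<epsilon>) \<le> real (card (bohr_set K (R * (1 - \<epsilon>))))"
    using reg \<open>0 < \<epsilon>\<close> unfolding regular_bohr_def by blast
  then have "real (card (bohr_set K R)) - real (card (bohr_set K (R * (1 - \<epsilon>))))
      \<le> 100 * real (card K) * \<epsilon> * real (card (bohr_set K R))"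
    by (simp add: algebra_simps)
  ultimately show ?thesis
    by (meson order_trans)
qed

lemma norm_diff_average_le:
  fixes G :: "'a \<Rightarrow> 'b \<Rightarrow> 'c \<Rightarrow> complex"
  assumes "finite H" "H \<noteq> {}" "finite L" "L \<noteq> {}"
    and E: "\<And>h k. h \<in> H \<Longrightarrow> k \<in> L \<Longrightarrow> cmod (S - (\<Sum>u\<in>C. G u h k)) \<le> E"
  shows "cmod (S - (\<Sum>u\<in>C. \<Sum>h\<in>H. \<Sum>k\<in>L. G u h k) / of_real (real (card H) * real (card L))) \<le> E"
proof -
  let ?m = "real (card H) * real (card L)"
  have m: "0 < ?m"
    using assms by (simp add: card_gt_0_iff)
  have "of_real ?m * S - (\<Sum>u\<in>C. \<Sum>h\<in>H. \<Sum>k\<in>L. G u h k) = (\<Sum>h\<in>H. \<Sum>k\<in>L. S - (\<Sum>u\<in>C. G u h k))"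
    by (subst sum_swap_inner) (simp add: sum_subtractf)
  also have "cmod \<dots> \<le> (\<Sum>h\<in>H. \<Sum>k\<in>L. E)"
    using E by (intro sum_norm_le)
  also have "\<dots> = ?m * E"
    by simp
  finally have "cmod (of_real ?m * S - (\<Sum>u\<in>C. \<Sum>h\<in>H. \<Sum>k\<in>L. G u h k)) \<le> ?m * E" .
  moreover have "of_real ?m * S - (\<Sum>u\<in>C. \<Sum>h\<in>H. \<Sum>k\<in>L. G u h k)
      = of_real ?m * (S - (\<Sum>u\<in>C. \<Sum>h\<in>H. \<Sum>k\<in>L. G u h k) / of_real ?m)"
  proof -
    have "of_real ?m \<noteq> (0 :: complex)"
      using m by (metis of_real_eq_0_iff less_irrefl)
    then show ?thesis
      by (simp only: right_diff_distrib times_divide_eq_right nonzero_mult_div_cancel_left not_False_eq_True)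
  qed
  ultimately have "?m * cmod (S - (\<Sum>u\<in>C. \<Sum>h\<in>H. \<Sum>k\<in>L. G u h k) / of_real ?m) \<le> ?m * E"
    using m by (simp only: norm_mult norm_of_real abs_of_pos)
  then show ?thesis
    using m by (simp only: mult_le_cancel_left_pos)
qed

section \<open>Small and large averages of bilinear phases\<close>

text \<open>Cauchy-Schwarz over \<open>k\<close> removes \<open>b\<close>. Expanding the square and
  using additivity of \<beta> in its first variable leaves sums over \<open>k\<close> at
  \<open>h - h'\<close>, most of which are small.\<close>

lemma norm_bilinear_sum_le:
  fixes \<beta> :: "'n::finite mod_ring \<Rightarrow> 'n mod_ring \<Rightarrow> 'n mod_ring"
  assumes a: "\<And>h. cmod (a h) \<le> 1" and b: "\<And>k. cmod (b k) \<le> 1"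
    and \<beta>: "\<And>h h' k. h \<in> H \<Longrightarrow> h' \<in> H \<Longrightarrow> k \<in> H \<Longrightarrow> \<beta> (h - h') k = \<beta> h k - \<beta> h' k"
    and \<delta>: "0 \<le> \<delta>"
    and few: "\<And>h'. h' \<in> H \<Longrightarrow>
      real (card {h \<in> H. \<delta> * real (card H) \<le> cmod (\<Sum>k\<in>H. omega_pow (\<beta> (h - h') k))}) \<le> \<delta> * real (card H)"
  shows "cmod (\<Sum>h\<in>H. \<Sum>k\<in>H. a h * b k * omega_pow (\<beta> h k)) \<le> sqrt (2 * \<delta>) * (real (card H))\<^sup>2"
proof -
  let ?m = "real (card H)"
  define X where "X k = (\<Sum>h\<in>H. a h * omega_pow (\<beta> h k))" for k
  define E where "E = (\<Sum>k\<in>H. (cmod (X k))\<^sup>2)"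
  define Y where "Y h h' = cmod (\<Sum>k\<in>H. omega_pow (\<beta> (h - h') k))" for h h'
  have Y_le: "Y h h' \<le> ?m" for h h'
    unfolding Y_def by (rule order_trans[OF norm_sum]) simp
  have sum_Y: "(\<Sum>h\<in>H. Y h h') \<le> 2 * \<delta> * ?m\<^sup>2" if h': "h' \<in> H" for h'
  proof -
    \<comment> \<open>Exceptional \<open>h\<close> get the trivial bound \<open>card H\<close>, all
      others the bound \<open>\<delta> * card H\<close>. Each kind contributes
      \<open>\<delta> * (card H)\<^sup>2\<close>, whence the factor 2.\<close>
    have "(\<Sum>h\<in>H. Y h h') \<le> (\<Sum>h\<in>H. (if \<delta> * ?m \<le> Y h h' then ?m else 0) + \<delta> * ?m)"
    proof (rule sum_mono)
      fix h
      have "0 \<le> \<delta> * ?m"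
        using \<delta> by simp
      then show "Y h h' \<le> (if \<delta> * ?m \<le> Y h h' then ?m else 0) + \<delta> * ?m"
        using Y_le[of h h'] by simp
    qed
    also have "\<dots> = ?m * real (card {h \<in> H. \<delta> * ?m \<le> Y h h'}) + ?m * (\<delta> * ?m)"
      by (simp add: sum.distrib flip: sum.inter_filter)
    also have "\<dots> \<le> ?m * (\<delta> * ?m) + ?m * (\<delta> * ?m)"
      using few[OF h'] unfolding Y_def by (intro add_right_mono mult_left_mono) auto
    finally show ?thesis
      by (simp add: power2_eq_square)
  qed
  have "of_real E = (\<Sum>k\<in>H. \<Sum>h\<in>H. \<Sum>h'\<in>H. a h * cnj (a h') * omega_pow (\<beta> (h - h') k))"
    unfolding E_def X_def of_real_sum norm_sum_squared by (simp add: \<beta> omega_pow_diff ac_simps)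
  also have "\<dots> = (\<Sum>h\<in>H. \<Sum>h'\<in>H. a h * cnj (a h') * (\<Sum>k\<in>H. omega_pow (\<beta> (h - h') k)))"
    unfolding sum_distrib_left by (rule sum_swap_inner)
  finally have "cmod (of_real E) = cmod (\<Sum>h\<in>H. \<Sum>h'\<in>H. a h * cnj (a h') * (\<Sum>k\<in>H. omega_pow (\<beta> (h - h') k)))"
    by (rule arg_cong)
  moreover have "0 \<le> E"
    by (simp add: E_def sum_nonneg)
  ultimately have "E = cmod (\<Sum>h\<in>H. \<Sum>h'\<in>H. a h * cnj (a h') * (\<Sum>k\<in>H. omega_pow (\<beta> (h - h') k)))"
    by simp
  also have "\<dots> \<le> (\<Sum>h\<in>H. \<Sum>h'\<in>H. Y h h')"
  proof (intro sum_norm_le)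
    fix h h'
    have "cmod (a h) * cmod (a h') \<le> 1"
      using a[of h] a[of h'] by (simp add: mult_le_one)
    then show "cmod (a h * cnj (a h') * (\<Sum>k\<in>H. omega_pow (\<beta> (h - h') k))) \<le> Y h h'"
      unfolding Y_def norm_mult complex_mod_cnj by (intro mult_left_le_one_le) auto
  qed
  also have "\<dots> = (\<Sum>h'\<in>H. \<Sum>h\<in>H. Y h h')"
    by (rule sum.swap)
  also have "\<dots> \<le> (\<Sum>h'\<in>H. 2 * \<delta> * ?m\<^sup>2)"
    using sum_Y by (rule sum_mono)
  finally have E: "E \<le> ?m * (2 * \<delta> * ?m\<^sup>2)"
    by simp
  have "(\<Sum>h\<in>H. \<Sum>k\<in>H. a h * b k * omega_pow (\<beta> h k)) = (\<Sum>k\<in>H. b k * X k)"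
    unfolding X_def sum_distrib_left by (subst sum.swap) (simp add: ac_simps)
  then have "(cmod (\<Sum>h\<in>H. \<Sum>k\<in>H. a h * b k * omega_pow (\<beta> h k)))\<^sup>2 \<le> ?m * E"
    unfolding E_def using norm_sum_unit_mult_le[of H b X] b by simp
  also have "\<dots> \<le> ?m * (?m * (2 * \<delta> * ?m\<^sup>2))"
    using E by (rule mult_left_mono) simp
  also have "\<dots> = (sqrt (2 * \<delta>) * ?m\<^sup>2)\<^sup>2"
    using \<delta> by (simp add: power_mult_distrib) (simp add: power2_eq_square power4_eq_xxxx)
  finally show ?thesis
    by (rule power2_le_imp_le) (use \<delta> in simp)
qed

text \<open>Shifting by \<open>k0\<close> multiplies the sum by \<open>omega_pow \<gamma>0\<close>
  and yet changes it little, so a large sum forces this factor to be near 1. The sum over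
  \<open>C\<close> mediates because additivity is given only on \<open>C\<close>: both it and its
  rotation are within \<open>\<eta> * card A\<close> of the sum over \<open>A\<close>.\<close>

lemma character_near_1:
  fixes \<gamma> :: "'n::finite mod_ring \<Rightarrow> 'n mod_ring"
  assumes sub: "C \<subseteq> A" "(\<lambda>k. k + k0) ` C \<subseteq> A" and "A \<noteq> {}"
    and hom: "\<And>k. k \<in> C \<Longrightarrow> \<gamma> (k + k0) = \<gamma> k + \<gamma>0"
    and \<eta>: "real (card A) - real (card C) \<le> \<eta> * real (card A)"
    and \<delta>: "\<delta> * real (card A) \<le> cmod (\<Sum>k\<in>A. omega_pow (\<gamma> k))"
  shows "\<delta> * cmod (omega_pow \<gamma>0 - 1) \<le> 2 * \<eta>"
proof -
  define S where "S = (\<Sum>k\<in>A. omega_pow (\<gamma> k))"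
  define S' where "S' = (\<Sum>k\<in>C. omega_pow (\<gamma> k))"
  have A: "0 < real (card A)"
    using \<open>A \<noteq> {}\<close> by (simp add: card_gt_0_iff)
  have "(\<Sum>k\<in>C. omega_pow (\<gamma> (k + k0))) = omega_pow \<gamma>0 * S'"
    unfolding S'_def by (simp add: hom omega_pow_add sum_distrib_left mult.commute)
  then have 1: "cmod (S - omega_pow \<gamma>0 * S') \<le> \<eta> * real (card A)"
    using norm_sum_diff_shift_le[OF sub(2), of "\<lambda>k. omega_pow (\<gamma> k)"] \<eta> by (simp add: S_def)
  have 2: "cmod (S - S') \<le> \<eta> * real (card A)"
    using norm_sum_diff_shift_le[of 0 C A "\<lambda>k. omega_pow (\<gamma> k)"] \<eta> sub(1) by (simp add: S_def S'_def)
  have "cmod S * cmod (omega_pow \<gamma>0 - 1) = cmod (omega_pow \<gamma>0 * (S - S') - (S - omega_pow \<gamma>0 * S'))"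
    unfolding norm_mult[symmetric] by (rule arg_cong[where f = cmod]) (simp add: algebra_simps)
  also have "\<dots> \<le> cmod (omega_pow \<gamma>0 * (S - S')) + cmod (S - omega_pow \<gamma>0 * S')"
    by (rule norm_triangle_ineq4)
  also have "\<dots> \<le> 2 * \<eta> * real (card A)"
    using 1 2 by (simp add: norm_mult)
  finally have "(\<delta> * real (card A)) * cmod (omega_pow \<gamma>0 - 1) \<le> 2 * \<eta> * real (card A)"
    using mult_right_mono[OF \<delta>, of "cmod (omega_pow \<gamma>0 - 1)"] by (simp add: S_def)
  then have "real (card A) * (\<delta> * cmod (omega_pow \<gamma>0 - 1)) \<le> real (card A) * (2 * \<eta>)"
    by (simp add: ac_simps)
  then show ?thesis
    using A by (simp only: mult_le_cancel_left_pos)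
qed

section \<open>The bilinear form of a quadratic map\<close>

definition second_diff :: "('n::finite mod_ring \<Rightarrow> 'n mod_ring) \<Rightarrow> 'n mod_ring \<Rightarrow> 'n mod_ring \<Rightarrow> 'n mod_ring" where
  "second_diff q h k = q (h + k) - q h - q k + q 0"

lemma second_diff_commute: "second_diff q h k = second_diff q k h"
  by (simp add: second_diff_def add.commute)

lemma bohr_set_cube:
  assumes "u \<in> bohr_set K r" "h \<in> bohr_set K s" "k \<in> bohr_set K t"
    and "0 \<le> r" "0 \<le> s" "0 \<le> t" "r + s + t \<le> R"
  shows "{0, u, h, k, u + h, u + k, h + k, u + h + k} \<subseteq> bohr_set K R"
proof -
  note adds = bohr_set_add[OF assms(1,2)] bohr_set_add[OF assms(1,3)] bohr_set_add[OF assms(2,3)]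
    bohr_set_add[OF bohr_set_add[OF assms(1,2)] assms(3)]
  have "v \<in> bohr_set K R" if "v \<in> bohr_set K x" "x \<le> R" for v x
    using that bohr_set_mono by blast
  then show ?thesis
    using assms adds by (auto intro: bohr_set_0)
qed

text \<open>This is the cube condition at vertex 0 with sides \<open>u\<close>, \<open>h\<close>,
  \<open>k\<close>, solved for the far vertex. It says that the mixed difference in the directions
  \<open>h\<close> and \<open>k\<close> is the same at \<open>u\<close> as at 0.\<close>

lemma quadratic_second_diff:
  assumes q: "quadratic_map_on (bohr_set K R) q"
    and mem: "u \<in> bohr_set K r" "h \<in> bohr_set K s" "k \<in> bohr_set K t"
      "0 \<le> r" "0 \<le> s" "0 \<le> t" "r + s + t \<le> R"
  shows "q (u + h + k) = q (u + h) + q (u + k) - q u + second_diff q h k"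
proof -
  have "{0, 0 + u, 0 + h, 0 + k, 0 + u + h, 0 + u + k, 0 + h + k, 0 + u + h + k} \<subseteq> bohr_set K R"
    using bohr_set_cube[OF mem] by simp
  then have "q 0 - q (0 + u) - q (0 + h) - q (0 + k)
      + q (0 + u + h) + q (0 + u + k) + q (0 + h + k) - q (0 + u + h + k) = 0"
    by (rule q[unfolded quadratic_map_on_def, rule_format])
  then have "q 0 - q u - q h - q k + q (u + h) + q (u + k) + q (h + k) - q (u + h + k) = 0"
    by simp
  then show ?thesis
    unfolding second_diff_def by (simp add: algebra_simps)
qed

text \<open>Apply \<open>quadratic_second_diff\<close> at the base point \<open>k\<close> in the
  directions \<open>h\<close> and \<open>k'\<close>.\<close>

lemma second_diff_add:
  assumes "quadratic_map_on (bohr_set K R) q"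
    and "h \<in> bohr_set K r" "k \<in> bohr_set K s" "k' \<in> bohr_set K t"
      "0 \<le> r" "0 \<le> s" "0 \<le> t" "r + s + t \<le> R"
  shows "second_diff q h (k + k') = second_diff q h k + second_diff q h k'"
  using quadratic_second_diff[OF assms(1,3,2,4)] assms(5-8)
  by (simp add: second_diff_def algebra_simps)

lemma second_diff_diff:
  assumes "quadratic_map_on (bohr_set K R) q"
    and "h \<in> bohr_set K s" "h' \<in> bohr_set K s" "k \<in> bohr_set K s" "0 \<le> s" "4 * s \<le> R"
  shows "second_diff q (h - h') k = second_diff q h k - second_diff q h' k"
proof -
  \<comment> \<open>Symmetry moves the difference to the second variable. As \<open>h - h'\<close>
    has radius \<open>2 * s\<close>, the three radii sum to \<open>4 * s\<close>.\<close>
  have "second_diff q k (h' + (h - h')) = second_diff q k h' + second_diff q k (h - h')"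
    using assms(3-6) bohr_set_diff[OF assms(2,3)]
    by (intro second_diff_add[OF assms(1), where r = s and s = s and t = "s + s"]) auto
  then show ?thesis
    by (simp add: second_diff_commute[of q _ k])
qed

lemma freiman_hom_on_cube:
  assumes "freiman_hom_on A \<phi>" "{u, u + h, u + k, u + h + k} \<subseteq> A"
  shows "\<phi> (u + h + k) = \<phi> (u + h) + \<phi> (u + k) - \<phi> u"
proof -
  have "\<phi> (u + h + k) + \<phi> u = \<phi> (u + h) + \<phi> (u + k)"
    using assms(2) by (intro assms(1)[unfolded freiman_hom_on_def, rule_format]) (auto simp: ac_simps)
  then show ?thesis
    by (simp add: algebra_simps)
qed

text \<open>Freiman homomorphisms and linear terms have zero mixed difference, so only
  \<open>q\<close> contributes one. The term \<open>c * u\<close> accommodates the character of a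
  Fourier coefficient.\<close>

lemma quadratic_phase_second_diff:
  assumes "quadratic_map_on (bohr_set K R) q" and "freiman_hom_on (bohr_set K R) \<phi>"
    and mem: "u \<in> bohr_set K r" "h \<in> bohr_set K s" "k \<in> bohr_set K t"
      "0 \<le> r" "0 \<le> s" "0 \<le> t" "r + s + t \<le> R"
    and p: "\<And>u. p u = q u + \<phi> u + c * u"
  shows "p (u + h + k) = p (u + h) + p (u + k) - p u + second_diff q h k"
proof -
  have "\<phi> (u + h + k) = \<phi> (u + h) + \<phi> (u + k) - \<phi> u"
    using bohr_set_cube[OF mem] by (intro freiman_hom_on_cube[OF assms(2)]) auto
  then show ?thesis
    unfolding p quadratic_second_diff[OF assms(1) mem] by (simp add: algebra_simps)
qed

text \<open>Averaging over shifts by \<open>h + k\<close>, both of radius \<open>s\<close>, costs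
  the regularity error. For fixed \<open>u\<close> the phase becomes a function of \<open>h\<close>
  plus a function of \<open>k\<close> plus \<open>second_diff q h k\<close>, so
  \<open>norm_bilinear_sum_le\<close> applies.\<close>

lemma norm_quadratic_exponential_sum_le:
  assumes reg: "regular_bohr K R" and quad: "quadratic_map_on (bohr_set K R) q"
    and \<phi>: "freiman_hom_on (bohr_set K R) \<phi>"
    and \<sigma>: "0 < \<sigma>" "4 * \<sigma> \<le> 1" and s: "0 \<le> s" "s \<le> \<sigma> * R"
    and \<delta>: "0 \<le> \<delta>"
    and few: "\<And>h'. h' \<in> bohr_set K s \<Longrightarrow>
      real (card {h \<in> bohr_set K s. \<delta> * real (card (bohr_set K s))
        \<le> cmod (\<Sum>k\<in>bohr_set K s. omega_pow (second_diff q (h - h') k))}) \<le> \<delta> * real (card (bohr_set K s))"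
  shows "cmod (\<Sum>u\<in>bohr_set K R. omega_pow (q u + \<phi> u + c * u))
    \<le> (300 * real (card K) * \<sigma> + sqrt (2 * \<delta>)) * real (card (bohr_set K R))"
proof -
  define H where "H = bohr_set K s"
  \<comment> \<open>The margin \<open>3 * \<sigma> * R\<close> covers the shift by
    \<open>h + k\<close>. The structured case, with \<open>h\<close> of radius
    \<open>2 * \<sigma> * R\<close> and \<open>k\<close> of radius \<open>\<sigma> * R\<close>, has
    the same margin and hence the same error.\<close>
  define C where "C = bohr_set K (R * (1 - 3 * \<sigma>))"
  define p where "p u = q u + \<phi> u + c * u" for u
  define S where "S = (\<Sum>u\<in>bohr_set K R. omega_pow (p u))"
  define E where "E = 300 * real (card K) * \<sigma> * real (card (bohr_set K R))"
  let ?m = "real (card H) * real (card H)"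
  have "0 \<le> \<sigma> * R"
    using s by linarith
  then have R: "0 \<le> R"
    using \<sigma>(1) by (simp add: zero_le_mult_iff)
  have sR: "4 * s \<le> R"
    using s(2) mult_right_mono[OF \<sigma>(2) R] by simp
  have r: "0 \<le> R * (1 - 3 * \<sigma>)"
    using R \<sigma> by simp
  have H: "H \<noteq> {}" "0 < ?m"
    using bohr_set_card_pos[OF s(1), of K] unfolding H_def by auto
  have CR: "card C \<le> card (bohr_set K R)"
    unfolding C_def using R \<sigma> by (intro card_mono bohr_set_mono) (auto simp: mult_left_le)
  have shift: "cmod (S - (\<Sum>u\<in>C. omega_pow (p (u + h + k)))) \<le> E" if "h \<in> H" "k \<in> H" for h k
  proof -
    have "h + k \<in> bohr_set K (3 * \<sigma> * R)"
      using bohr_set_add[of h K s k s] bohr_set_mono[of "s + s" "3 * \<sigma> * R" K] that s \<open>0 \<le> \<sigma> * R\<close>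
      by (auto simp: H_def)
    then show ?thesis
      using regular_bohr_shift[OF reg, of "3 * \<sigma>" "h + k" "\<lambda>u. omega_pow (p u)"] \<sigma>
      by (simp add: S_def C_def E_def add.assoc mult.assoc)
  qed
  have avg: "cmod (S - (\<Sum>u\<in>C. \<Sum>h\<in>H. \<Sum>k\<in>H. omega_pow (p (u + h + k))) / of_real ?m) \<le> E"
    using H(1) shift by (intro norm_diff_average_le) auto
  have inner: "cmod (\<Sum>h\<in>H. \<Sum>k\<in>H. omega_pow (p (u + h + k))) \<le> sqrt (2 * \<delta>) * (real (card H))\<^sup>2"
    if "u \<in> C" for u
  proof -
    have "p (u + h + k) = p (u + h) + (p (u + k) - p u) + second_diff q h k" if "h \<in> H" "k \<in> H" for h k
    proof -
      have "R * (1 - 3 * \<sigma>) + s + s \<le> R"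
        using s \<open>0 \<le> \<sigma> * R\<close> by (simp add: algebra_simps)
      then have "p (u + h + k) = p (u + h) + p (u + k) - p u + second_diff q h k"
        using \<open>u \<in> C\<close> that unfolding C_def H_def
        by (intro quadratic_phase_second_diff[OF quad \<phi> _ _ _ r s(1) s(1) _ p_def])
      then show ?thesis
        by (simp only: add_diff_eq)
    qed
    then have "(\<Sum>h\<in>H. \<Sum>k\<in>H. omega_pow (p (u + h + k)))
        = (\<Sum>h\<in>H. \<Sum>k\<in>H. omega_pow (p (u + h)) * omega_pow (p (u + k) - p u) * omega_pow (second_diff q h k))"
      by (simp add: omega_pow_add)
    also have "cmod \<dots> \<le> sqrt (2 * \<delta>) * (real (card H))\<^sup>2"
    proof (rule norm_bilinear_sum_le)
      show "second_diff q (h - h') k = second_diff q h k - second_diff q h' k"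
        if "h \<in> H" "h' \<in> H" "k \<in> H" for h h' k
        using that s(1) sR unfolding H_def by (rule second_diff_diff[OF quad])
      show "real (card {h \<in> H. \<delta> * real (card H) \<le> cmod (\<Sum>k\<in>H. omega_pow (second_diff q (h - h') k))})
          \<le> \<delta> * real (card H)" if "h' \<in> H" for h'
        using few that unfolding H_def .
    qed (use \<delta> in auto)
    finally show ?thesis .
  qed
  have "cmod (\<Sum>u\<in>C. \<Sum>h\<in>H. \<Sum>k\<in>H. omega_pow (p (u + h + k))) \<le> (\<Sum>u\<in>C. sqrt (2 * \<delta>) * (real (card H))\<^sup>2)"
    using inner by (rule sum_norm_le)
  also have "\<dots> = real (card C) * (sqrt (2 * \<delta>) * ?m)"
    by (simp add: power2_eq_square)
  also have "\<dots> \<le> real (card (bohr_set K R)) * (sqrt (2 * \<delta>) * ?m)"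
    using CR \<delta> by (intro mult_right_mono) auto
  finally have "cmod ((\<Sum>u\<in>C. \<Sum>h\<in>H. \<Sum>k\<in>H. omega_pow (p (u + h + k))) / of_real ?m)
      \<le> real (card (bohr_set K R)) * sqrt (2 * \<delta>)"
    using H(2) by (simp only: norm_divide norm_of_real abs_of_pos pos_divide_le_eq mult.assoc)
  then have "cmod S \<le> E + real (card (bohr_set K R)) * sqrt (2 * \<delta>)"
    using avg norm_triangle_sub[of S "(\<Sum>u\<in>C. \<Sum>h\<in>H. \<Sum>k\<in>H. omega_pow (p (u + h + k))) / of_real ?m"]
    by linarith
  then show ?thesis
    by (simp add: S_def p_def E_def algebra_simps)
qed

section \<open>Generalized quadratic averages\<close>

text \<open>Substituting \<open>y = x - u\<close> moves the average onto the base itself; the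
  homomorphism used at \<open>u\<close> is then the one attached to \<open>x - u\<close>.\<close>

lemma quadratic_averageD:
  assumes "quadratic_average K R q Q"
  shows "\<exists>\<phi>. (\<forall>y. freiman_hom_on (bohr_set K R) (\<phi> y)) \<and>
    (\<forall>x. Q x = (\<Sum>u\<in>bohr_set K R. omega_pow (q u + \<phi> (x - u) u)) / of_nat (card (bohr_set K R)))"
proof -
  obtain \<phi> where hom: "\<And>y. freiman_hom_on (bohr_set K R) (\<phi> y)"
    and Q: "\<And>x. Q x = expect ((\<lambda>u. x - u) ` bohr_set K R) (\<lambda>y. omega_pow (q (x - y) + \<phi> y (x - y)))"
    using assms unfolding quadratic_average_def by blast
  have inj: "inj_on (\<lambda>u. x - u) (bohr_set K R)" for x
    by (rule inj_onI) simp
  have "Q x = (\<Sum>u\<in>bohr_set K R. omega_pow (q u + \<phi> (x - u) u)) / of_nat (card (bohr_set K R))" for x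
    unfolding Q expect_def by (simp add: sum.reindex[OF inj] card_image[OF inj])
  then show ?thesis
    using hom by blast
qed

lemma norm_quadratic_average_le:
  assumes "quadratic_average K R q Q"
  shows "cmod (Q x) \<le> 1"
proof -
  let ?m = "real (card (bohr_set K R))"
  obtain \<phi> where "Q x = (\<Sum>u\<in>bohr_set K R. omega_pow (q u + \<phi> (x - u) u)) / of_nat (card (bohr_set K R))"
    using quadratic_averageD[OF assms] by blast
  moreover have "cmod (\<Sum>u\<in>bohr_set K R. omega_pow (q u + \<phi> (x - u) u)) \<le> ?m"
    by (rule order_trans[OF norm_sum]) simp
  \<comment> \<open>For negative \<open>R\<close> the Bohr set can be empty; the quotient by zero
    then makes \<open>Q x\<close> equal to 0.\<close>
  ultimately show ?thesis
    by (auto simp: norm_divide divide_le_eq_1 card_gt_0_iff)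
qed

text \<open>Ordering the double sum by \<open>y = x - u\<close> fixes the homomorphism: each
  \<open>y\<close> contributes a unimodular factor times one exponential sum over the base, with
  \<open>r * u\<close> added to the phase.\<close>

lemma norm_quadratic_average_Fourier_le:
  fixes Q :: "'n::finite mod_ring \<Rightarrow> complex"
  assumes Q: "quadratic_average K R q Q" and R: "0 \<le> R"
    and M: "\<And>\<phi>. freiman_hom_on (bohr_set K R) \<phi> \<Longrightarrow>
      cmod (\<Sum>u\<in>bohr_set K R. omega_pow (q u + \<phi> u + r * u)) \<le> M * real (card (bohr_set K R))"
  shows "cmod (\<Sum>x\<in>UNIV. Q x * omega_pow (r * x)) \<le> real CARD('n) * M"
proof -
  let ?m = "real (card (bohr_set K R))"
  have m: "0 < ?m"
    using bohr_set_card_pos[OF R, of K] by simp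
  obtain \<phi> where hom: "\<And>y. freiman_hom_on (bohr_set K R) (\<phi> y)"
    and Q: "\<And>x. Q x = (\<Sum>u\<in>bohr_set K R. omega_pow (q u + \<phi> (x - u) u)) / of_nat (card (bohr_set K R))"
    using quadratic_averageD[OF Q] by blast
  define S where "S y = (\<Sum>u\<in>bohr_set K R. omega_pow (q u + \<phi> y u + r * u))" for y
  have "(\<Sum>x\<in>UNIV. Q x * omega_pow (r * x))
      = (\<Sum>x\<in>UNIV. \<Sum>u\<in>bohr_set K R. omega_pow (q u + \<phi> (x - u) u) * omega_pow (r * x)) / of_real ?m"
    by (simp add: Q sum_distrib_right sum_divide_distrib)
  also have "(\<Sum>x\<in>UNIV. \<Sum>u\<in>bohr_set K R. omega_pow (q u + \<phi> (x - u) u) * omega_pow (r * x))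
      = (\<Sum>u\<in>bohr_set K R. \<Sum>x\<in>UNIV. omega_pow (q u + \<phi> (x - u) u) * omega_pow (r * x))"
    by (rule sum.swap)
  also have "\<dots> = (\<Sum>u\<in>bohr_set K R. \<Sum>y\<in>UNIV. omega_pow (r * y) * omega_pow (q u + \<phi> y u + r * u))"
  proof -
    have "(\<Sum>x\<in>UNIV. omega_pow (q u + \<phi> (x - u) u) * omega_pow (r * x))
        = (\<Sum>y\<in>UNIV. omega_pow (r * y) * omega_pow (q u + \<phi> y u + r * u))" for u
      by (rule sum.reindex_bij_witness[where i = "\<lambda>y. y + u" and j = "\<lambda>x. x - u"])
        (simp_all add: algebra_simps flip: omega_pow_add)
    then show ?thesis
      by simp
  qed
  also have "\<dots> = (\<Sum>y\<in>UNIV. \<Sum>u\<in>bohr_set K R. omega_pow (r * y) * omega_pow (q u + \<phi> y u + r * u))"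
    by (rule sum.swap)
  also have "\<dots> = (\<Sum>y\<in>UNIV. omega_pow (r * y) * S y)"
    by (simp add: S_def sum_distrib_left)
  finally have eq: "(\<Sum>x\<in>UNIV. Q x * omega_pow (r * x)) = (\<Sum>y\<in>UNIV. omega_pow (r * y) * S y) / of_real ?m" .
  have "cmod (\<Sum>y\<in>UNIV. omega_pow (r * y) * S y) \<le> (\<Sum>y\<in>(UNIV :: 'n mod_ring set). M * ?m)"
    using M[OF hom] by (intro sum_norm_le) (simp add: norm_mult S_def)
  then show ?thesis
    using m unfolding eq by (simp add: norm_divide pos_divide_le_eq mult.assoc)
qed

lemma norm_average_le:
  fixes f :: "nat \<Rightarrow> complex"
  assumes "1 \<le> n" "\<And>i. i < n \<Longrightarrow> cmod (f i) \<le> c"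
  shows "cmod ((\<Sum>i<n. f i) / of_nat n) \<le> c"
proof -
  have "cmod (\<Sum>i<n. f i) \<le> (\<Sum>i<n. c)"
    using assms(2) by (intro sum_norm_le) auto
  then show ?thesis
    using assms(1) by (simp add: norm_divide pos_divide_le_eq mult.commute)
qed

text \<open>Fourier coefficients of a mean are means of Fourier coefficients, and \<open>M\<close>
  is uniform in the homomorphism and the frequency.\<close>

lemma generalized_quadratic_average_U2_norm_le:
  fixes Q :: "'n::finite mod_ring \<Rightarrow> complex"
  assumes gqa: "generalized_quadratic_average K R q Q" and R: "0 \<le> R"
    and M: "\<And>\<phi> r. freiman_hom_on (bohr_set K R) \<phi> \<Longrightarrow>
      cmod (\<Sum>u\<in>bohr_set K R. omega_pow (q u + \<phi> u + r * u)) \<le> M * real (card (bohr_set K R))"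
  shows "U2_norm Q ^ 4 \<le> M\<^sup>2"
proof -
  obtain n and Qs :: "nat \<Rightarrow> 'n mod_ring \<Rightarrow> complex" where n: "1 \<le> n"
    and Qs: "\<And>i. i < n \<Longrightarrow> quadratic_average K R q (Qs i)"
    and Q: "\<And>x. Q x = (\<Sum>i<n. Qs i x) / of_nat n"
    using gqa unfolding generalized_quadratic_average_def by blast
  show ?thesis
  proof (rule U2_norm_le_Fourier)
    show "cmod (Q x) \<le> 1" for x
      unfolding Q using n norm_quadratic_average_le[OF Qs] by (intro norm_average_le)
    show "cmod (\<Sum>x\<in>UNIV. Q x * omega_pow (r * x)) \<le> real CARD('n) * M" for r
    proof -
      have "(\<Sum>x\<in>UNIV. Q x * omega_pow (r * x)) = (\<Sum>x\<in>UNIV. \<Sum>i<n. Qs i x * omega_pow (r * x)) / of_nat n"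
        by (simp add: Q sum_distrib_right sum_divide_distrib)
      also have "\<dots> = (\<Sum>i<n. \<Sum>x\<in>UNIV. Qs i x * omega_pow (r * x)) / of_nat n"
        by (subst sum.swap) simp
      finally show ?thesis
        using n M by (simp only:) (intro norm_average_le norm_quadratic_average_Fourier_le[OF Qs R])
    qed
  qed
qed

section \<open>Structured approximation of quadratic averages\<close>

text \<open>After the shift by \<open>h + k\<close> the homomorphism is the one attached to
  \<open>y = z - u - h - k\<close>. Dropping the factor
  \<open>omega_pow (second_diff q h k)\<close>, which is within \<gamma> of 1, leaves for each
  \<open>u\<close> a function of \<open>y\<close> and \<open>h\<close> times a function of
  \<open>y\<close> and \<open>k\<close>. This is the form that
  \<open>U2_dual_norm_bilinear_average\<close> needs.\<close>

lemma quadratic_average_approx: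
  fixes Q :: "'n::finite mod_ring \<Rightarrow> complex"
  assumes reg: "regular_bohr K R" and quad: "quadratic_map_on (bohr_set K R) q" and R: "0 \<le> R"
    and hom: "\<And>y. freiman_hom_on (bohr_set K R) (\<phi> y)"
    and Q: "Q z = (\<Sum>u\<in>bohr_set K R. omega_pow (q u + \<phi> (z - u) u)) / of_nat (card (bohr_set K R))"
    and \<sigma>: "0 < \<sigma>" "4 * \<sigma> \<le> 1"
    and H: "H \<noteq> {}" "H \<subseteq> bohr_set K (2 * \<sigma> * R)" and L: "L \<noteq> {}" "L \<subseteq> bohr_set K (\<sigma> * R)"
    and \<gamma>: "\<And>h k. h \<in> H \<Longrightarrow> k \<in> L \<Longrightarrow> cmod (omega_pow (second_diff q h k) - 1) \<le> \<gamma>"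
    and p: "\<And>y u. p y u = q u + \<phi> y u"
  shows "cmod (Q z - (\<Sum>u\<in>bohr_set K (R * (1 - 3 * \<sigma>)). \<Sum>h\<in>H. \<Sum>k\<in>L.
      omega_pow (p (z - u - h - k) (u + h)) * omega_pow (p (z - u - h - k) (u + k) - p (z - u - h - k) u))
      / of_real (real (card (bohr_set K R)) * real (card H) * real (card L)))
    \<le> 300 * real (card K) * \<sigma> + \<gamma>"
proof -
  define C where "C = bohr_set K (R * (1 - 3 * \<sigma>))"
  define G where "G u = omega_pow (q u + \<phi> (z - u) u)" for u
  define X where "X u h k = omega_pow (p (z - u - h - k) (u + h)) *
    omega_pow (p (z - u - h - k) (u + k) - p (z - u - h - k) u)" for u h k
  let ?b = "real (card (bohr_set K R))"
  have b: "0 < ?b"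
    using bohr_set_card_pos[OF R, of K] by simp
  have \<sigma>R: "0 \<le> \<sigma> * R" and r: "0 \<le> R * (1 - 3 * \<sigma>)"
    using R \<sigma> by auto
  have CR: "real (card C) \<le> ?b"
    unfolding C_def using R \<sigma> by (intro of_nat_mono card_mono bohr_set_mono) (auto simp: mult_left_le)
  have "0 \<le> \<gamma>"
    using \<gamma> H(1) L(1) norm_ge_zero order_trans by blast
  have "cmod ((\<Sum>u\<in>bohr_set K R. G u) - (\<Sum>u\<in>C. X u h k)) \<le> 300 * real (card K) * \<sigma> * ?b + \<gamma> * ?b"
    if hk: "h \<in> H" "k \<in> L" for h k
  proof -
    have hk': "h \<in> bohr_set K (2 * \<sigma> * R)" "k \<in> bohr_set K (\<sigma> * R)"
      using hk H(2) L(2) by auto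
    then have "h + k \<in> bohr_set K (3 * \<sigma> * R)"
      using bohr_set_add[OF hk'] by (simp add: algebra_simps)
    then have 1: "cmod ((\<Sum>u\<in>bohr_set K R. G u) - (\<Sum>u\<in>C. G (u + (h + k)))) \<le> 300 * real (card K) * \<sigma> * ?b"
      using regular_bohr_shift[OF reg, of "3 * \<sigma>" "h + k" G] \<sigma> by (simp add: C_def G_def mult.assoc)
    have GX: "cmod (G (u + (h + k)) - X u h k) \<le> \<gamma>" if "u \<in> C" for u
    proof -
      let ?y = "z - u - h - k"
      have "R * (1 - 3 * \<sigma>) + 2 * \<sigma> * R + \<sigma> * R \<le> R"
        by (simp add: algebra_simps)
      then have "p ?y (u + h + k) = p ?y (u + h) + p ?y (u + k) - p ?y u + second_diff q h k"
        using that hk' r \<sigma>R unfolding C_def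
        by (intro quadratic_phase_second_diff[OF quad hom, where c = 0 and r = "R * (1 - 3 * \<sigma>)"
              and s = "2 * \<sigma> * R" and t = "\<sigma> * R"]) (auto simp: p mult.commute)
      also have "\<dots> = p ?y (u + h) + (p ?y (u + k) - p ?y u) + second_diff q h k"
        by (simp only: add_diff_eq)
      finally have "omega_pow (p ?y (u + h + k)) = X u h k * omega_pow (second_diff q h k)"
        by (simp only: X_def omega_pow_add)
      moreover have "G (u + (h + k)) = omega_pow (p ?y (u + h + k))"
        by (simp add: G_def p algebra_simps)
      ultimately have "G (u + (h + k)) - X u h k = X u h k * (omega_pow (second_diff q h k) - 1)"
        by (simp add: right_diff_distrib)
      then show ?thesis
        using \<gamma>[OF hk] by (simp add: norm_mult X_def)
    qed
    have "cmod ((\<Sum>u\<in>C. G (u + (h + k))) - (\<Sum>u\<in>C. X u h k)) \<le> (\<Sum>u\<in>C. \<gamma>)"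
      unfolding sum_subtractf[symmetric] using GX by (rule sum_norm_le)
    also have "\<dots> \<le> \<gamma> * ?b"
      using CR \<open>0 \<le> \<gamma>\<close> by (simp add: mult.commute mult_left_mono)
    finally show ?thesis
      using 1 norm_triangle_ineq[of "(\<Sum>u\<in>bohr_set K R. G u) - (\<Sum>u\<in>C. G (u + (h + k)))"
          "(\<Sum>u\<in>C. G (u + (h + k))) - (\<Sum>u\<in>C. X u h k)"] by simp
  qed
  then have avg: "cmod ((\<Sum>u\<in>bohr_set K R. G u)
      - (\<Sum>u\<in>C. \<Sum>h\<in>H. \<Sum>k\<in>L. X u h k) / of_real (real (card H) * real (card L)))
      \<le> 300 * real (card K) * \<sigma> * ?b + \<gamma> * ?b"
    using H(1) L(1) by (intro norm_diff_average_le) auto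
  have "Q z - (\<Sum>u\<in>C. \<Sum>h\<in>H. \<Sum>k\<in>L. X u h k) / of_real (?b * real (card H) * real (card L))
      = ((\<Sum>u\<in>bohr_set K R. G u)
      - (\<Sum>u\<in>C. \<Sum>h\<in>H. \<Sum>k\<in>L. X u h k) / of_real (real (card H) * real (card L))) / of_real ?b"
    by (simp only: Q G_def diff_divide_distrib divide_divide_eq_left of_real_mult of_real_of_nat_eq
        mult.commute mult.left_commute)
  then have "cmod (Q z - (\<Sum>u\<in>C. \<Sum>h\<in>H. \<Sum>k\<in>L. X u h k) / of_real (?b * real (card H) * real (card L)))
      \<le> (300 * real (card K) * \<sigma> * ?b + \<gamma> * ?b) / ?b"
    using avg b by (simp only: norm_divide norm_of_real abs_of_pos divide_right_mono order.strict_implies_order)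
  also have "\<dots> = 300 * real (card K) * \<sigma> + \<gamma>"
    unfolding distrib_right[symmetric] using b by (intro nonzero_mult_div_cancel_right) linarith
  finally show ?thesis
    unfolding X_def C_def .
qed

text \<open>All \<open>n\<close> averages are merged into one family indexed by
  \<open>t = (i, u)\<close> and share \<open>H\<close> and \<open>L\<close>, so the dual norm bound
  does not depend on \<open>n\<close>.\<close>

lemma generalized_quadratic_average_approx:
  fixes Q :: "'n::finite mod_ring \<Rightarrow> complex"
  assumes gqa: "generalized_quadratic_average K R q Q" and R: "0 \<le> R"
    and \<sigma>: "0 < \<sigma>" "4 * \<sigma> \<le> 1"
    and H: "H \<noteq> {}" "H \<subseteq> bohr_set K (2 * \<sigma> * R)" and L: "L \<noteq> {}" "L \<subseteq> bohr_set K (\<sigma> * R)"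
    and \<gamma>: "\<And>h k. h \<in> H \<Longrightarrow> k \<in> L \<Longrightarrow> cmod (omega_pow (second_diff q h k) - 1) \<le> \<gamma>"
  shows "\<exists>Q''. (\<forall>z. cmod (Q z - Q'' z) \<le> 300 * real (card K) * \<sigma> + \<gamma>) \<and>
    U2_dual_norm Q'' \<le> real CARD('n) / sqrt (real (card H) * real (card L))"
proof -
  obtain n and Qs :: "nat \<Rightarrow> 'n mod_ring \<Rightarrow> complex" where n: "1 \<le> n"
    and Qs: "\<And>i. i < n \<Longrightarrow> quadratic_average K R q (Qs i)"
    and Q: "\<And>x. Q x = (\<Sum>i<n. Qs i x) / of_nat n"
    using gqa unfolding generalized_quadratic_average_def by blast
  have reg: "regular_bohr K R" and quad: "quadratic_map_on (bohr_set K R) q"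
    using Qs[of 0] n unfolding quadratic_average_def by auto
  have "\<forall>i. \<exists>\<phi>. i < n \<longrightarrow> (\<forall>y. freiman_hom_on (bohr_set K R) (\<phi> y)) \<and>
      (\<forall>x. Qs i x = (\<Sum>u\<in>bohr_set K R. omega_pow (q u + \<phi> (x - u) u)) / of_nat (card (bohr_set K R)))"
    using quadratic_averageD[OF Qs] by blast
  from choice[OF this] obtain \<phi> where hom: "\<And>i y. i < n \<Longrightarrow> freiman_hom_on (bohr_set K R) (\<phi> i y)"
    and Qs_eq: "\<And>i x. i < n \<Longrightarrow>
      Qs i x = (\<Sum>u\<in>bohr_set K R. omega_pow (q u + \<phi> i (x - u) u)) / of_nat (card (bohr_set K R))"
    by blast
  define C where "C = bohr_set K (R * (1 - 3 * \<sigma>))"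
  define p where "p i y u = q u + \<phi> i y u" for i y u
  define a where "a t y h = omega_pow (p (fst t) y (snd t + h))" for t y h
  define b where "b t y k = omega_pow (p (fst t) y (snd t + k) - p (fst t) y (snd t))" for t y k
  let ?B = "real (card (bohr_set K R))"
  have B: "0 < ?B"
    using bohr_set_card_pos[OF R, of K] by simp
  define Q1 where "Q1 i z = (\<Sum>u\<in>C. \<Sum>h\<in>H. \<Sum>k\<in>L. a (i, u) (z - u - h - k) h * b (i, u) (z - u - h - k) k)
    / of_real (?B * real (card H) * real (card L))" for i z
  define Q'' where "Q'' z = (\<Sum>t\<in>{..<n} \<times> C. \<Sum>h\<in>H. \<Sum>k\<in>L. a t (z - snd t - h - k) h * b t (z - snd t - h - k) k)
    / of_real (real n * ?B * real (card H) * real (card L))" for z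
  have Q''_eq: "Q'' z = (\<Sum>i<n. Q1 i z) / of_nat n" for z
  proof -
    have "Q'' z = (\<Sum>i<n. \<Sum>u\<in>C. \<Sum>h\<in>H. \<Sum>k\<in>L. a (i, u) (z - u - h - k) h * b (i, u) (z - u - h - k) k)
        / of_real (real n * (?B * real (card H) * real (card L)))"
      unfolding Q''_def sum.cartesian_product[of _ C "{..<n}"] by (simp only: case_prod_unfold prod.collapse mult.assoc)
    also have "\<dots> = (\<Sum>i<n. Q1 i z) / of_nat n"
      unfolding Q1_def sum_divide_distrib[symmetric] by (simp only: divide_divide_eq_left of_real_mult of_real_of_nat_eq mult.commute)
    finally show ?thesis .
  qed
  have "cmod (Q z - Q'' z) \<le> 300 * real (card K) * \<sigma> + \<gamma>" for z
  proof -
    have "cmod (Qs i z - Q1 i z) \<le> 300 * real (card K) * \<sigma> + \<gamma>" if "i < n" for i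
      unfolding Q1_def a_def b_def C_def fst_conv snd_conv
      by (rule quadratic_average_approx[OF reg quad R hom[OF that] Qs_eq[OF that] \<sigma> H L \<gamma> p_def])
    then have "cmod ((\<Sum>i<n. Qs i z - Q1 i z) / of_nat n) \<le> 300 * real (card K) * \<sigma> + \<gamma>"
      using n by (intro norm_average_le)
    then show ?thesis
      by (simp add: Q Q''_eq sum_subtractf diff_divide_distrib)
  qed
  moreover have "U2_dual_norm Q'' \<le> real CARD('n) / sqrt (real (card H) * real (card L))"
    unfolding Q''_def
  proof (rule U2_dual_norm_bilinear_average)
    have "card C \<le> card (bohr_set K R)"
      unfolding C_def using R \<sigma> by (intro card_mono bohr_set_mono) (auto simp: mult_left_le)
    then show "real (card ({..<n} \<times> C)) \<le> real n * ?B"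
      by (simp add: card_cartesian_product mult_left_mono)
    show "0 < real n * ?B"
      using n B by simp
  qed (use H L in \<open>auto simp: a_def b_def\<close>)
  ultimately show ?thesis
    by blast
qed

text \<open>\<open>H\<close> consists of the differences \<open>h - h'\<close> with a large
  character sum. Stability lets \<open>character_near_1\<close> run with
  \<open>\<eta> = \<delta>\<^sup>2 / 2\<close>, which bounds \<delta> times the distance to 1 by
  \<open>\<delta>\<^sup>2\<close>.\<close>

lemma exists_bohr_rectangle:
  fixes K :: "'n::finite mod_ring set"
  assumes quad: "quadratic_map_on (bohr_set K R) q"
    and s: "3 * s \<le> R" and \<tau>: "0 \<le> \<tau>" "\<tau> \<le> s"
    and stable: "real (card (bohr_set K s)) - real (card (bohr_set K (s - \<tau>))) \<le> \<delta>\<^sup>2 / 2 * real (card (bohr_set K s))"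
    and \<delta>: "0 < \<delta>" and h': "h' \<in> bohr_set K s"
    and many: "\<delta> * real (card (bohr_set K s)) < real (card {h \<in> bohr_set K s. \<delta> * real (card (bohr_set K s))
        \<le> cmod (\<Sum>k\<in>bohr_set K s. omega_pow (second_diff q (h - h') k))})"
  shows "\<exists>H. H \<subseteq> bohr_set K (2 * s) \<and> \<delta> * real (card (bohr_set K s)) < real (card H) \<and>
    (\<forall>h\<in>H. \<forall>k\<in>bohr_set K \<tau>. cmod (omega_pow (second_diff q h k) - 1) \<le> \<delta>)"
proof -
  define A where "A = bohr_set K s"
  define H0 where "H0 = {h \<in> A. \<delta> * real (card A) \<le> cmod (\<Sum>k\<in>A. omega_pow (second_diff q (h - h') k))}"
  define H where "H = (\<lambda>h. h - h') ` H0"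
  have "card H = card H0"
    unfolding H_def by (rule card_image) (simp add: inj_on_def)
  then have card_H: "\<delta> * real (card A) < real (card H)"
    using many by (simp add: H0_def A_def)
  have H_sub: "H \<subseteq> bohr_set K (2 * s)"
  proof
    fix x assume "x \<in> H"
    then obtain h where "h \<in> bohr_set K s" "x = h - h'"
      unfolding H_def H0_def A_def by blast
    then show "x \<in> bohr_set K (2 * s)"
      using bohr_set_diff[of h K s h' s] h' by simp
  qed
  have "cmod (omega_pow (second_diff q h k0) - 1) \<le> \<delta>" if h: "h \<in> H" and k0: "k0 \<in> bohr_set K \<tau>" for h k0
  proof -
    have "\<delta> * cmod (omega_pow (second_diff q h k0) - 1) \<le> 2 * (\<delta>\<^sup>2 / 2)"
    proof (rule character_near_1[where A = A and C = "bohr_set K (s - \<tau>)" and \<gamma> = "second_diff q h" and ?k0.0 = k0])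
      show "bohr_set K (s - \<tau>) \<subseteq> A"
        unfolding A_def using \<tau> by (intro bohr_set_mono) simp
      show "(\<lambda>k. k + k0) ` bohr_set K (s - \<tau>) \<subseteq> A"
        using bohr_set_add[OF _ k0] by (fastforce simp: A_def)
      show "A \<noteq> {}"
        using h' by (auto simp: A_def)
      \<comment> \<open>The radii \<open>2 * s\<close>, \<open>s - \<tau>\<close> and \<tau> sum to
        \<open>3 * s\<close>.\<close>
      show "second_diff q h (k + k0) = second_diff q h k + second_diff q h k0" if "k \<in> bohr_set K (s - \<tau>)" for k
        using h H_sub that k0 s \<tau>
        by (intro second_diff_add[OF quad, where r = "2 * s" and s = "s - \<tau>" and t = \<tau>]) auto
      show "real (card A) - real (card (bohr_set K (s - \<tau>))) \<le> \<delta>\<^sup>2 / 2 * real (card A)"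
        using stable by (simp add: A_def)
      show "\<delta> * real (card A) \<le> cmod (\<Sum>k\<in>A. omega_pow (second_diff q h k))"
        using h by (auto simp: H_def H0_def)
    qed
    then have "\<delta> * cmod (omega_pow (second_diff q h k0) - 1) \<le> \<delta> * \<delta>"
      by (simp add: power2_eq_square)
    then show ?thesis
      using \<delta> by (simp only: mult_le_cancel_left_pos)
  qed
  then show ?thesis
    using card_H H_sub unfolding A_def by blast
qed

section \<open>Numerical estimates\<close>

text \<open>The chain is \<open>M\<^sup>2 \<le> 18 * \<alpha>\<^sup>2 + 4 * \<alpha> \<le> 5 *
  \<alpha>\<close>, then
  \<open>U ^ 8 \<le> 25 * \<alpha>\<^sup>2 \<le> 12 * \<alpha>\<close>.\<close>

lemma le_powr_eighth:
  fixes U M \<alpha> :: real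
  assumes U: "0 \<le> U" "U ^ 4 \<le> M\<^sup>2" and M: "0 \<le> M" "M \<le> 3 * \<alpha> + sqrt (2 * \<alpha>)" and \<alpha>: "0 < \<alpha>" "\<alpha> \<le> 1 / 20"
  shows "U \<le> (12 * \<alpha>) powr (1 / 8)"
proof -
  have "M\<^sup>2 \<le> (3 * \<alpha> + sqrt (2 * \<alpha>))\<^sup>2"
    using M by (intro power_mono) auto
  also have "\<dots> \<le> 2 * (3 * \<alpha>)\<^sup>2 + 2 * (sqrt (2 * \<alpha>))\<^sup>2"
    using sum_squares_bound[of "3 * \<alpha>" "sqrt (2 * \<alpha>)"] by (simp add: power2_sum)
  also have "\<dots> = \<alpha> * (18 * \<alpha> + 4)"
    using \<alpha> by (simp add: power2_eq_square algebra_simps)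
  also have "\<dots> \<le> \<alpha> * 5"
    using \<alpha> by (intro mult_left_mono) auto
  finally have "U ^ 4 \<le> \<alpha> * 5"
    using U by linarith
  then have "(U ^ 4)\<^sup>2 \<le> (\<alpha> * 5)\<^sup>2"
    using U by (intro power_mono) auto
  also have "\<dots> = \<alpha> * (25 * \<alpha>)"
    by (simp add: power2_eq_square)
  also have "\<dots> \<le> \<alpha> * 12"
    using \<alpha> by (intro mult_left_mono) auto
  finally have U8: "U ^ 8 \<le> 12 * \<alpha>"
    by (simp flip: power_mult)
  show ?thesis
  proof (cases "U = 0")
    case False
    then have "U powr 8 = U ^ 8"
      using U by simp
    then have "(U ^ 8) powr (1 / 8) = U powr (8 * (1 / 8))"
      by (metis powr_powr)
    then have "U = (U ^ 8) powr (1 / 8)"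
      using U by simp
    also have "\<dots> \<le> (12 * \<alpha>) powr (1 / 8)"
      using U8 U by (intro powr_mono2) auto
    finally show ?thesis .
  qed simp
qed

text \<open>The outer \<open>1 / \<alpha>\<close> is enlarged to its \<open>d\<close>-th power, so
  each factor \<open>M\<close> receives one. Together with the cube in the bound for
  \<open>M\<close> this gives \<open>1 / \<alpha> ^ 4\<close>, and \<open>36 ^ d\<close> is absorbed
  by \<open>4 ^ (4 * d) = 256 ^ d\<close>.\<close>

lemma dual_bound_numeric:
  fixes M \<alpha> \<rho> :: real
  assumes d: "1 \<le> d" and \<rho>: "0 < \<rho>" and \<alpha>: "0 < \<alpha>" "\<alpha> \<le> 1 / 20"
    and M: "0 \<le> M" "M \<le> 4200 * real d * 36 ^ d / (\<alpha> ^ 3 * \<rho>)"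
  shows "M ^ d / \<alpha> \<le> (4 / \<alpha>) ^ (4 * d\<^sup>2) * (800 * (real d)\<^sup>2 / \<rho>) ^ d"
proof -
  \<comment> \<open>Since \<open>256 / 36 = 64 / 9\<close>, the spare factor reduces 4200 to less
    than 591, below the 800 available.\<close>
  have "(64 / 9 :: real) ^ 1 \<le> (64 / 9) ^ d"
    using d by (intro power_increasing) auto
  then have "36 ^ d * (64 / 9) \<le> 36 ^ d * (64 / 9 :: real) ^ d"
    by (intro mult_left_mono) auto
  then have "36 ^ d * (64 / 9) \<le> (256 :: real) ^ d"
    by (simp flip: power_mult_distrib)
  moreover have "(0 :: real) \<le> 36 ^ d"
    by simp
  ultimately have "4200 * 36 ^ d \<le> 800 * (256 :: real) ^ d"
    by linarith
  moreover have "real d \<le> (real d)\<^sup>2"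
    using d by (simp add: power2_eq_square)
  ultimately have "(4200 * 36 ^ d) * real d \<le> (800 * 256 ^ d) * (real d)\<^sup>2"
    by (rule mult_mono) auto
  moreover have "1 / \<alpha> ^ 4 \<le> 1 / \<alpha> ^ (4 * d)"
    using \<alpha> d by (intro divide_left_mono power_decreasing) auto
  ultimately have "(4200 * 36 ^ d) * real d * (1 / \<alpha> ^ 4) \<le> (800 * 256 ^ d) * (real d)\<^sup>2 * (1 / \<alpha> ^ (4 * d))"
    by (rule mult_mono) (use \<alpha> in auto)
  then have "(4200 * 36 ^ d) * real d * (1 / \<alpha> ^ 4) * (1 / \<rho>)
      \<le> (800 * 256 ^ d) * (real d)\<^sup>2 * (1 / \<alpha> ^ (4 * d)) * (1 / \<rho>)"
    using \<rho> by (intro mult_right_mono) auto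
  moreover have "(4200 * 36 ^ d) * real d * (1 / \<alpha> ^ 4) * (1 / \<rho>)
      = 4200 * real d * 36 ^ d / (\<alpha> ^ 3 * \<rho>) * (1 / \<alpha>)"
    by (simp add: power4_eq_xxxx power3_eq_cube ac_simps)
  moreover have "(800 * 256 ^ d) * (real d)\<^sup>2 * (1 / \<alpha> ^ (4 * d)) * (1 / \<rho>)
      = (4 / \<alpha>) ^ (4 * d) * (800 * (real d)\<^sup>2 / \<rho>)"
    by (simp add: power_divide power_mult)
  moreover have "M * (1 / \<alpha>) \<le> 4200 * real d * 36 ^ d / (\<alpha> ^ 3 * \<rho>) * (1 / \<alpha>)"
    using M \<alpha> by (intro mult_right_mono) auto
  ultimately have factor: "M * (1 / \<alpha>) \<le> (4 / \<alpha>) ^ (4 * d) * (800 * (real d)\<^sup>2 / \<rho>)"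
    by linarith
  have "(1 / \<alpha>) ^ 1 \<le> (1 / \<alpha>) ^ d"
    using \<alpha> d by (intro power_increasing) auto
  then have "M ^ d / \<alpha> \<le> M ^ d * (1 / \<alpha>) ^ d"
    using mult_left_mono[of "1 / \<alpha>" "(1 / \<alpha>) ^ d" "M ^ d"] M by simp
  also have "\<dots> = (M * (1 / \<alpha>)) ^ d"
    by (rule power_mult_distrib[symmetric])
  also have "\<dots> \<le> ((4 / \<alpha>) ^ (4 * d) * (800 * (real d)\<^sup>2 / \<rho>)) ^ d"
    using factor M \<alpha> by (intro power_mono) auto
  also have "\<dots> = (4 / \<alpha>) ^ (4 * d\<^sup>2) * (800 * (real d)\<^sup>2 / \<rho>) ^ d"
    by (simp only: power_mult_distrib[of "(4 / \<alpha>) ^ (4 * d)"] power2_eq_square[of d] mult.assoc[symmetric]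
        power_mult[symmetric])
  finally show ?thesis .
qed

lemma card_UNIV_div_bohr_set_le:
  fixes K :: "'n::finite mod_ring set"
  assumes "card K \<le> d" and "0 < t" and "t \<le> 1 / 2"
  shows "\<exists>M\<ge>0. M \<le> 7 / t \<and> real CARD('n) / real (card (bohr_set K t)) \<le> M ^ d"
proof -
  define M where "M = nat \<lceil>2 * pi / t\<rceil>"
  have M_ge: "2 * pi / t \<le> real M"
    unfolding M_def by linarith
  moreover have pos: "0 < 2 * pi / t"
    using assms(2) by simp
  ultimately have "0 < real M"
    by linarith
  then have M: "0 < M"
    by simp
  have "2 * pi / real M \<le> t"
    using M_ge M assms(2) by (simp add: divide_le_eq mult.commute)
  then have "CARD('n) \<le> M ^ card K * card (bohr_set K t)"
    by (rule card_UNIV_le_bohr_set[OF M])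
  also have "\<dots> \<le> M ^ d * card (bohr_set K t)"
    using M assms(1) by (intro mult_right_mono power_increasing) auto
  finally have "real CARD('n) \<le> real (M ^ d * card (bohr_set K t))"
    by (simp only: of_nat_le_iff)
  then have "real CARD('n) / real (card (bohr_set K t)) \<le> real M ^ d"
    using bohr_set_card_pos[of t K] assms(2) by (simp add: divide_le_eq)
  moreover have "real M \<le> 7 / t"
  proof -
    have "real M \<le> 2 * pi / t + 1"
      unfolding M_def using pos by linarith
    \<comment> \<open>The 1 lost by rounding up is at most \<open>0.5 / t\<close> because
      \<open>t \<le> 1 / 2\<close>.\<close>
    also have "\<dots> \<le> 6.4 / t + 0.5 / t"
      using assms pi_approx by (intro add_mono divide_right_mono) (auto simp: field_simps)
    also have "\<dots> \<le> 7 / t"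
      using assms(2) by (simp add: field_simps)
    finally show ?thesis .
  qed
  ultimately show ?thesis
    by (intro exI[of _ "real M"]) auto
qed

theorem theorem6p11:
  fixes Q :: "'n::finite mod_ring \<Rightarrow> complex" and d :: nat and \<rho> \<alpha> :: real
  assumes "1 \<le> d" and "0 < \<rho>" and "\<rho> \<le> 2"
    and "gqa_of_complexity_at_most d \<rho> Q"
    and "0 < \<alpha>" and "\<alpha> \<le> 1 / 20"
  shows "U2_norm Q \<le> (12 * \<alpha>) powr (1 / 8) \<or>
    (\<exists>Q'' :: 'n mod_ring \<Rightarrow> complex.
      sup_norm (\<lambda>x. Q x - Q'' x) \<le> 16 * (real d)\<^sup>2 * \<alpha> \<and>
      U2_dual_norm Q'' \<le> (4 / \<alpha>) ^ (4 * d\<^sup>2) * (800 * (real d)\<^sup>2 / \<rho>) ^ d)"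
proof -
  obtain K :: "'n mod_ring set" and R q where K: "card K \<le> d" and R: "\<rho> \<le> R"
    and gqa: "generalized_quadratic_average K R q Q"
    using assms(4) unfolding gqa_of_complexity_at_most_def by blast
  have R0: "0 < R"
    using R assms(2) by simp
  \<comment> \<open>Since \<open>n \<ge> 1\<close>, at least one average exists, and it carries the
    regularity and the quadratic property of the base.\<close>
  have "\<exists>Q0. quadratic_average K R q Q0"
    using gqa unfolding generalized_quadratic_average_def by (metis less_le_trans zero_less_one)
  then have reg: "regular_bohr K R" and quad: "quadratic_map_on (bohr_set K R) q"
    unfolding quadratic_average_def by auto
  \<comment> \<open>Chosen so that the regularity error \<open>300 * card K * \<sigma>\<close> is at
    most \<open>3 * \<alpha>\<close>.\<close>
  define \<sigma> where "\<sigma> = \<alpha> / (100 * real d)"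
  \<comment> \<open>Large enough that \<open>36 ^ d / J \<le> \<alpha>\<^sup>2 / 2\<close>, the
    stability required by \<open>exists_bohr_rectangle\<close> with
    \<open>\<delta> = \<alpha>\<close>.\<close>
  define J where "J = nat \<lceil>2 * 36 ^ d / \<alpha>\<^sup>2\<rceil>"
  \<comment> \<open>The stable radius lies between \<open>r\<close> and \<open>2 * r\<close>, hence
    is at most \<open>\<sigma> * R\<close>.\<close>
  define r where "r = \<sigma> * R / 2"
  define \<tau> where "\<tau> = r / real J"
  have \<sigma>0: "0 < \<sigma>"
    using assms by (simp add: \<sigma>_def)
  have \<sigma>\<alpha>: "\<sigma> \<le> \<alpha>"
    using assms by (simp add: \<sigma>_def divide_le_eq)
  have \<sigma>1: "4 * \<sigma> \<le> 1"
    using \<sigma>\<alpha> assms(6) by linarith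
  have err: "300 * real (card K) * \<sigma> \<le> 3 * \<alpha>"
  proof -
    have "300 * real (card K) * \<sigma> \<le> 300 * real d * \<sigma>"
      using K \<sigma>0 by simp
    then show ?thesis
      using assms(1) by (simp add: \<sigma>_def)
  qed
  have J_pos: "0 < 2 * 36 ^ d / \<alpha>\<^sup>2"
    using assms by simp
  have J_ge: "2 * 36 ^ d / \<alpha>\<^sup>2 \<le> real J"
    unfolding J_def by linarith
  have J0: "0 < J"
    using J_pos J_ge by (metis less_le_trans of_nat_0_less_iff)
  have r0: "0 < r"
    using \<sigma>0 R0 by (simp add: r_def)
  have \<tau>: "0 < \<tau>" "\<tau> \<le> r"
    using r0 J0 by (auto simp: \<tau>_def divide_le_eq)
  obtain s where s: "r \<le> s" "s \<le> 2 * r"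
    and s_stable: "real (card (bohr_set K s)) - real (card (bohr_set K (s - \<tau>)))
      \<le> 36 ^ card K / real J * real (card (bohr_set K s))"
    using exists_stable_radius[OF r0 J0] unfolding \<tau>_def by blast
  have sR: "s \<le> \<sigma> * R"
    using s(2) by (simp add: r_def)
  have s0: "0 \<le> s"
    using r0 s(1) by simp
  have s4: "4 * s \<le> R"
    using sR mult_right_mono[OF \<sigma>1, of R] R0 by linarith
  have "36 ^ card K / real J \<le> 36 ^ d / real J"
    using K by (intro divide_right_mono power_increasing) auto
  also have "\<dots> \<le> \<alpha>\<^sup>2 / 2"
    using J_ge J0 assms(5) by (simp add: field_simps)
  finally have stable: "real (card (bohr_set K s)) - real (card (bohr_set K (s - \<tau>)))
      \<le> \<alpha>\<^sup>2 / 2 * real (card (bohr_set K s))"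
    using s_stable mult_right_mono[of "36 ^ card K / real J" "\<alpha>\<^sup>2 / 2" "real (card (bohr_set K s))"] by linarith
  show ?thesis
  \<comment> \<open>The same \<alpha> is the threshold for a large character sum and for the
    proportion of exceptional \<open>h\<close>.\<close>
  proof (cases "\<forall>h'\<in>bohr_set K s. real (card {h \<in> bohr_set K s. \<alpha> * real (card (bohr_set K s))
        \<le> cmod (\<Sum>k\<in>bohr_set K s. omega_pow (second_diff q (h - h') k))}) \<le> \<alpha> * real (card (bohr_set K s))")
    case True
    define M where "M = 300 * real (card K) * \<sigma> + sqrt (2 * \<alpha>)"
    have "U2_norm Q ^ 4 \<le> M\<^sup>2"
    proof (rule generalized_quadratic_average_U2_norm_le[OF gqa])
      show "cmod (\<Sum>u\<in>bohr_set K R. omega_pow (q u + \<phi> u + c * u)) \<le> M * real (card (bohr_set K R))"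
        if "freiman_hom_on (bohr_set K R) \<phi>" for \<phi> c
        unfolding M_def using True assms(5)
        by (intro norm_quadratic_exponential_sum_le[OF reg quad that \<sigma>0 \<sigma>1 s0 sR]) auto
    qed (use R0 in simp)
    then have "U2_norm Q \<le> (12 * \<alpha>) powr (1 / 8)"
      using U2_norm_nonneg err \<sigma>0 assms(5,6) by (intro le_powr_eighth[of _ M]) (auto simp: M_def)
    then show ?thesis ..
  next
    case False
    then obtain h' where h': "h' \<in> bohr_set K s"
      and many: "\<alpha> * real (card (bohr_set K s)) < real (card {h \<in> bohr_set K s. \<alpha> * real (card (bohr_set K s))
        \<le> cmod (\<Sum>k\<in>bohr_set K s. omega_pow (second_diff q (h - h') k))})"
      by (auto simp: not_le)
    have "3 * s \<le> R" "0 \<le> \<tau>" "\<tau> \<le> s"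
      using s s4 s0 \<tau> by auto
    from exists_bohr_rectangle[OF quad this stable assms(5) h' many]
    obtain H where H: "H \<subseteq> bohr_set K (2 * s)" "\<alpha> * real (card (bohr_set K s)) < real (card H)"
      and \<gamma>: "\<And>h k. h \<in> H \<Longrightarrow> k \<in> bohr_set K \<tau> \<Longrightarrow> cmod (omega_pow (second_diff q h k) - 1) \<le> \<alpha>"
      by blast
    define L where "L = bohr_set K \<tau>"
    have L0: "0 < real (card L)"
      using bohr_set_card_pos[of \<tau> K] \<tau> by (simp add: L_def)
    have "0 \<le> \<alpha> * real (card (bohr_set K s))"
      using assms(5) by simp
    then have H_ne: "H \<noteq> {}"
      using H(2) by auto
    have H_sub: "H \<subseteq> bohr_set K (2 * \<sigma> * R)"
      using H(1) bohr_set_mono[of "2 * s" "2 * \<sigma> * R" K] sR by auto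
    have L_sub: "L \<subseteq> bohr_set K (\<sigma> * R)" "L \<noteq> {}"
      using bohr_set_mono[of \<tau> "\<sigma> * R" K] \<open>\<tau> \<le> s\<close> sR L0 by (auto simp: L_def)
    obtain Q'' where close: "\<And>z. cmod (Q z - Q'' z) \<le> 300 * real (card K) * \<sigma> + \<alpha>"
      and dual: "U2_dual_norm Q'' \<le> real CARD('n) / sqrt (real (card H) * real (card L))"
      using generalized_quadratic_average_approx[OF gqa _ \<sigma>0 \<sigma>1 H_ne H_sub L_sub(2,1) \<gamma>] R0
      unfolding L_def by (auto simp: less_imp_le)
    have "sup_norm (\<lambda>x. Q x - Q'' x) \<le> 300 * real (card K) * \<sigma> + \<alpha>"
      unfolding sup_norm_def using close by (intro Max.boundedI) auto
    \<comment> \<open>Regularity accounts for \<open>3 * \<alpha>\<close>, the omitted bilinear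
      factors for the last \<alpha>.\<close>
    also have "\<dots> \<le> 4 * \<alpha>"
      using err by simp
    also have "\<dots> \<le> 16 * (real d)\<^sup>2 * \<alpha>"
    proof -
      have "1 \<le> (real d)\<^sup>2"
        using assms(1) by (intro one_le_power) simp
      then have "4 \<le> 16 * (real d)\<^sup>2"
        by linarith
      then show ?thesis
        using assms(5) by (intro mult_right_mono) auto
    qed
    finally have sup: "sup_norm (\<lambda>x. Q x - Q'' x) \<le> 16 * (real d)\<^sup>2 * \<alpha>" .
    \<comment> \<open>Both \<open>card H\<close> and \<open>card L\<close> are at least
      \<open>\<alpha> * card L\<close>. This crude bound leaves only the size of \<open>L\<close> to
      be estimated.\<close>
    have "\<alpha> * real (card L) \<le> sqrt (real (card H) * real (card L))"
    proof (rule real_le_rsqrt)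
      have "card L \<le> card (bohr_set K s)"
        unfolding L_def using \<open>\<tau> \<le> s\<close> by (intro card_mono bohr_set_mono) auto
      then have "\<alpha> * real (card L) \<le> \<alpha> * real (card (bohr_set K s))"
        using assms(5) by simp
      then have "\<alpha> * real (card L) \<le> real (card H)"
        using H(2) by linarith
      moreover have "\<alpha> * real (card L) \<le> 1 * real (card L)"
        using assms(6) by (intro mult_right_mono) auto
      ultimately show "(\<alpha> * real (card L))\<^sup>2 \<le> real (card H) * real (card L)"
        unfolding power2_eq_square using assms(5) by (intro mult_mono) auto
    qed
    then have "real CARD('n) / sqrt (real (card H) * real (card L)) \<le> real CARD('n) / (\<alpha> * real (card L))"
      using assms(5) L0 by (intro frac_le) auto
    with dual have dual: "U2_dual_norm Q'' \<le> real CARD('n) / real (card L) / \<alpha>"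
      by (simp add: mult.commute)
    \<comment> \<open>This is \<tau> with \<open>R\<close> replaced by its lower bound \<rho>, so
      that the final estimate depends on \<rho> alone.\<close>
    define t where "t = \<sigma> * \<rho> / (2 * real J)"
    have t: "0 < t" "t \<le> \<tau>"
      using \<sigma>0 assms(2) J0 R by (auto simp: t_def \<tau>_def r_def divide_right_mono)
    have "t \<le> 1 / 2"
    proof -
      have "\<sigma> * \<rho> \<le> 1 / 4 * 2"
        using \<sigma>0 \<sigma>1 assms(2,3) by (intro mult_mono) auto
      also have "\<dots> \<le> 1 / 2 * (2 * real J)"
        using J0 by simp
      finally show ?thesis
        using J0 by (simp add: t_def divide_le_eq)
    qed
    then obtain M where M: "0 \<le> M" "M \<le> 7 / t" "real CARD('n) / real (card (bohr_set K t)) \<le> M ^ d"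
      using card_UNIV_div_bohr_set_le[OF K t(1)] by blast
    have "card (bohr_set K t) \<le> card L"
      unfolding L_def using t by (intro card_mono bohr_set_mono) auto
    then have "real CARD('n) / real (card L) \<le> real CARD('n) / real (card (bohr_set K t))"
      using bohr_set_card_pos[of t K] t by (intro divide_left_mono) auto
    with M(3) have "real CARD('n) / real (card L) / \<alpha> \<le> M ^ d / \<alpha>"
      using assms(5) by (intro divide_right_mono) auto
    moreover have "M \<le> 4200 * real d * 36 ^ d / (\<alpha> ^ 3 * \<rho>)"
    proof -
      have "1 \<le> 36 ^ d / \<alpha>\<^sup>2"
      proof -
        have "\<alpha>\<^sup>2 \<le> 1"
          using assms(5,6) by (intro power_le_one) auto
        also have "(1 :: real) \<le> 36 ^ d"
          by simp
        finally show ?thesis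
          using assms(5) by simp
      qed
      moreover have "real J \<le> 2 * 36 ^ d / \<alpha>\<^sup>2 + 1"
        unfolding J_def using J_pos by linarith
      ultimately have "real J \<le> 3 * 36 ^ d / \<alpha>\<^sup>2"
        by simp
      then have "1400 * real d / (\<alpha> * \<rho>) * real J \<le> 1400 * real d / (\<alpha> * \<rho>) * (3 * 36 ^ d / \<alpha>\<^sup>2)"
        using assms(2,5) by (intro mult_left_mono) auto
      \<comment> \<open>Here \<open>1400 = 7 * 2 * 100\<close>, and the factor 3 in the bound for
        \<open>J\<close> turns it into 4200.\<close>
      moreover have "7 / t = 1400 * real d / (\<alpha> * \<rho>) * real J"
        using assms(1,2,5) J0 by (simp add: t_def \<sigma>_def)
      ultimately show ?thesis
        using M(2) by (simp add: power2_eq_square power3_eq_cube mult.commute mult.left_commute)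
    qed
    ultimately have "U2_dual_norm Q'' \<le> (4 / \<alpha>) ^ (4 * d\<^sup>2) * (800 * (real d)\<^sup>2 / \<rho>) ^ d"
      using dual dual_bound_numeric[OF assms(1,2,5,6) M(1)] by linarith
    with sup show ?thesis
      by blast
  qed
qed

end
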